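(* For all $p,q,r\ge 0$ with $n=p+q+r\ge 1$, the group $\mathrm{P}_{p,q,r}$ has the following equivalent definitions (it equals each of the following sets): (a) $(\mathcal{G}^{(0)\times}_{p,q,r}\cup\mathcal{G}^{(1)\times}_{p,q,r})\,\mathcal{G}^{0n\times}_{p,q,r}$ if $n$ is odd, and $\mathcal{G}^{(0)\times}_{p,q,r}\cup\mathcal{G}^{(1)\times}_{p,q,r}$ if $n$ is even; (b) $\{T\in\mathcal{G}^{\times}_{p,q,r}:\ \widehat{T^{-1}}T\in\mathrm{S}^{\times}_{p,q,r}\}$; (c) $\{T\in\mathcal{G}^{\times}_{p,q,r}:\ \widehat{T^{-1}}T\in\ker(\mathrm{ad})\}$; (d) $\{T\in\mathcal{G}^{\times}_{p,q,r}:\ \widehat{T^{-1}}T\in(\mathcal{G}^{0n}_{p,q,r}\oplus\mathrm{rad}\,\mathcal{G}^{(0)}_{p,q,r})^{\times}\}$ if $n$ is odd, and $\{T\in\mathcal{G}^{\times}_{p,q,r}:\ \widehat{T^{-1}}T\in(\mathcal{G}^{0}\oplus\mathrm{rad}\,\mathcal{G}^{(0)}_{p,q,r})^{\times}\}$ if $n$ is even; (e) $\{T\in\mathcal{G}^{\times}_{p,q,r}:\ \widehat{T^{-1}}T\in(\mathcal{G}^{0}\oplus\mathrm{rad}\,\mathcal{G}^{(0)}_{p,q,r})^{\times}\}$ if $n$ is even and $r\neq 0$, and $\{T\in\mathcal{G}^{\times}_{p,q,r}:\ \widehat{T^{-1}}T\in(\mathcal{G}^{0n}_{p,q,r}\oplus\mathrm{rad}\,\mathcal{G}^{(0)}_{p,q,r})^{\times}\}$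 in the other cases. Here $\mathrm{S}^{\times}_{p,q,r}=(\mathcal{G}^0\oplus\mathcal{G}^n_{p,q,r})^\times$ if $n$ is odd and $\mathcal{G}^{0\times}$ if $n$ is even, while $\ker(\mathrm{ad})=(\Lambda^{(0)}_r\oplus\mathcal{G}^n_{p,q,r})^\times$ if $n$ is odd and $\Lambda^{(0)\times}_r$ if $n$ is even. The group $\mathrm{P}^{\pm}_{p,q,r}$ has the following equivalent definitions (it equals each of the following sets): (a') $\mathcal{G}^{(0)\times}_{p,q,r}\cup\mathcal{G}^{(1)\times}_{p,q,r}$; (b') $\{T\in\mathcal{G}^{\times}_{p,q,r}:\ \widehat{T^{-1}}T\in\mathcal{G}^{0\times}\}$; (c') $\{T\in\mathcal{G}^{\times}_{p,q,r}:\ \widehat{T^{-1}}T\in\Lambda^{(0)\times}_r=\ker(\check{\mathrm{ad}})\}$; (d') $\{T\in\mathcal{G}^{\times}_{p,q,r}:\ \widehat{T^{-1}}T\in(\mathcal{G}^{0}\oplus\mathrm{rad}\,\mathcal{G}^{(0)}_{p,q,r})^{\times}\}$; (e') $\{T\in\mathcal{G}^{\times}_{p,q,r}:\ \widehat{T^{-1}}T\in(\mathcal{G}^{0n}_{p,q,r}\oplus\mathrm{rad}\,\mathcal{G}^{(0)}_{p,q,r})^{\times}\}$ if $n$ is even and $r=0$, and $\{T\in\mathcal{G}^{\times}_{p,q,r}:\ \widehat{T^{-1}}T\in(\mathcal{G}^{0}\oplus\mathrm{rad}\,\mathcal{G}^{(0)}_{p,q,r})^{\times}\}$ in the other cases.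
   Context: Let $\mathbb{F}=\mathbb{R}$ or $\mathbb{F}=\mathbb{C}$, let $p,q,r\ge 0$ be integers and $n=p+q+r\ge 1$. $\mathcal{G}_{p,q,r}$ denotes the (Clifford) geometric algebra: the unital associative $\mathbb{F}$-algebra of dimension $2^n$ with identity $e$ and generators $e_1,\dots,e_n$ satisfying $e_ae_b+e_be_a=2\eta_{ab}e$, where $\eta$ is the diagonal matrix whose diagonal is $p$ times $1$, then $q$ times $-1$, then $r$ times $0$ (if $\mathbb{F}=\mathbb{R}$), or $p+q$ times $1$, then $r$ times $0$ (if $\mathbb{F}=\mathbb{C}$). A basis is given by $e_{a_1\ldots a_k}:=e_{a_1}\cdots e_{a_k}$, $a_1<\dots<a_k$, $0\le k\le n$ (the empty product being $e$); $\mathcal{G}^k_{p,q,r}$ (grade $k$) is the span of those with $k$ indices, $\mathcal{G}^0=\mathbb{F}e$, and $\mathcal{G}^{0n}_{p,q,r}:=\mathcal{G}^0\oplus\mathcal{G}^n_{p,q,r}$. The grade involution $U\mapsto\widehat U$ is the algebra automorphism with $\widehat{e_a}=-e_a$. $\mathcal{G}^{(k)}_{p,q,r}=\{U:\widehat U=(-1)^kU\}$, $k=0,1$ (even and odd subspaces). $\Lambda_r=\mathcal{G}_{0,0,r}$ is the (Grassmann) subalgebra generated by $e$ and the null generators $e_{p+q+1},\dots,e_n$ ($\Lambda_0=\mathcal{G}^0$), and $\Lambda_r^{(0)}=\Lambda_r\cap\mathcal{G}^{(0)}_{p,q,r}$. $\mathrm{rad}\,\mathcal{G}_{p,q,r}$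 is the Jacobson radical of $\mathcal{G}_{p,q,r}$; it is the span of the basis elements $e_{a_1\ldots a_k}$ containing at least one index from $\{p+q+1,\dots,n\}$ (it is $\{0\}$ if $r=0$). $\mathrm{rad}\,\mathcal{G}^{(0)}_{p,q,r}$ denotes its even part $\mathrm{rad}\,\mathcal{G}_{p,q,r}\cap\mathcal{G}^{(0)}_{p,q,r}$. For a subset $A\subseteq\mathcal{G}_{p,q,r}$, $A^\times$ denotes the set of elements of $A$ invertible in $\mathcal{G}_{p,q,r}$. A product of subsets is the set of products of their elements. $\mathrm{Z}_{p,q,r}$ is the center of $\mathcal{G}_{p,q,r}$; it equals $\Lambda^{(0)}_r\oplus\mathcal{G}^n_{p,q,r}$ if $n$ is odd and $\Lambda^{(0)}_r$ if $n$ is even. $\mathrm{S}_{p,q,r}:=\mathcal{G}^0\oplus\mathcal{G}^n_{p,q,r}$ if $n$ is odd and $\mathrm{S}_{p,q,r}:=\mathcal{G}^0$ if $n$ is even. Groups: $\mathrm{P}^{\pm}_{p,q,r}:=\mathcal{G}^{(0)\times}_{p,q,r}\cup\mathcal{G}^{(1)\times}_{p,q,r}$ and $\mathrm{P}_{p,q,r}:=\mathrm{P}^{\pm}_{p,q,r}\mathrm{Z}^{\times}_{p,q,r}$. $\ker(\mathrm{ad})=\{T\in\mathcal{G}^\times_{p,q,r}:TUT^{-1}=U\ \forall U\in\mathcal{G}_{p,q,r}\}$ and $\ker(\check{\mathrm{ad}})=\{T\in\mathcal{G}^\times_{p,q,r}:\widehat{T}UT^{-1}=U\ \forall U\in\mathcal{G}_{p,q,r}\}$.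 *)

theory Defs
  imports Complex_Main "HOL-Library.Set_Algebras"
begin

text \<open>
  The identity of the algebra is \<^term>\<open>1::'a::ring_1\<close>; \<open>scal\<close> is the action of the scalars, and
  only \<open>gen G 1, \<dots>, gen G (dimn G)\<close> are meaningful.  Products and direct sums of subsets are the
  elementwise operations \<open>*\<close> and \<open>+\<close> on sets of Set Algebras.
\<close>

record ('f, 'a) geom_alg =
  scal :: "'f \<Rightarrow> 'a \<Rightarrow> 'a"
  gen :: "nat \<Rightarrow> 'a"
  pnum :: nat
  qnum :: nat
  rnum :: nat

definition dimn :: "('f, 'a, 'm) geom_alg_scheme \<Rightarrow> nat" where
  "dimn G = pnum G + qnum G + rnum G"

definition field_iso :: "('a::field \<Rightarrow> 'b::field) \<Rightarrow> bool" where
  "field_iso \<phi> \<longleftrightarrow>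
    bij \<phi> \<and> (\<forall>x y. \<phi> (x + y) = \<phi> x + \<phi> y \<and> \<phi> (x * y) = \<phi> x * \<phi> y)"

text \<open>
  The matrix \<open>\<eta>\<close>, where \<open>s\<close> is the diagonal value in the middle block: \<open>-1\<close> for real scalars and
  \<open>1\<close> for complex scalars.
\<close>

definition eta :: "'f::field \<Rightarrow> nat \<Rightarrow> nat \<Rightarrow> nat \<Rightarrow> nat \<Rightarrow> 'f" where
  "eta s p q a b =
    (if a \<noteq> b then 0 else if a \<le> p then 1 else if a \<le> p + q then s else 0)"

definition clifford_relations :: "('f::field, 'a::ring_1, 'm) geom_alg_scheme \<Rightarrow> 'f \<Rightarrow> bool" where
  "clifford_relations G s \<longleftrightarrow>
    (\<forall>a\<in>{1..dimn G}. \<forall>b\<in>{1..dimn G}.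
      gen G a * gen G b + gen G b * gen G a = scal G (2 * eta s (pnum G) (qnum G) a b) 1)"

definition subalgebra :: "('f::field, 'a::ring_1, 'm) geom_alg_scheme \<Rightarrow> 'a set \<Rightarrow> bool" where
  "subalgebra G S \<longleftrightarrow>
    module.subspace (scal G) S \<and> 1 \<in> S \<and> (\<forall>x\<in>S. \<forall>y\<in>S. x * y \<in> S)"

definition generated_subalgebra :: "('f::field, 'a::ring_1, 'm) geom_alg_scheme \<Rightarrow> 'a set \<Rightarrow> 'a set" where
  "generated_subalgebra G X = \<Inter> {S. subalgebra G S \<and> X \<subseteq> S}"

text \<open>
  The scalar field is \<open>\<real>\<close> or \<open>\<complex>\<close> up to isomorphism, so that both cases are covered by one type
  variable.  An infinite-dimensional space has \<open>dim = 0\<close>, so the dimension assumption includes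
  finite-dimensionality.
\<close>

locale geometric_algebra = vector_space "scal G"
  for G :: "('f::field, 'a::ring_1, 'm) geom_alg_scheme" +
  assumes scal_mult_left: "scal G c x * y = scal G c (x * y)"
    and scal_mult_right: "x * scal G c y = scal G c (x * y)"
    and scalars_relations:
      "((\<exists>\<phi> :: 'f \<Rightarrow> real. field_iso \<phi>) \<and> clifford_relations G (- 1)) \<or>
       ((\<exists>\<phi> :: 'f \<Rightarrow> complex. field_iso \<phi>) \<and> clifford_relations G 1)"
    and generated: "generated_subalgebra G (gen G ` {1..dimn G}) = UNIV"
    and dimension: "dim UNIV = 2 ^ dimn G"

definition blade :: "('f, 'a::ring_1, 'm) geom_alg_scheme \<Rightarrow> nat set \<Rightarrow> 'a" where
  "blade G A = prod_list (map (gen G) (sorted_list_of_set A))"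

definition grade :: "('f::field, 'a::ring_1, 'm) geom_alg_scheme \<Rightarrow> nat \<Rightarrow> 'a set" where
  "grade G k = module.span (scal G) {blade G A | A. A \<subseteq> {1..dimn G} \<and> card A = k}"

definition grade_0n :: "('f::field, 'a::ring_1, 'm) geom_alg_scheme \<Rightarrow> 'a set" where
  "grade_0n G = grade G 0 + grade G (dimn G)"

definition algebra_automorphism ::
    "('f::field, 'a::ring_1, 'm) geom_alg_scheme \<Rightarrow> ('a \<Rightarrow> 'a) \<Rightarrow> bool" where
  "algebra_automorphism G f \<longleftrightarrow>
    bij f \<and> f 1 = 1 \<and> (\<forall>x y. f (x + y) = f x + f y) \<and>
    (\<forall>c x. f (scal G c x) = scal G c (f x)) \<and> (\<forall>x y. f (x * y) = f x * f y)"

definition hat :: "('f::field, 'a::ring_1, 'm) geom_alg_scheme \<Rightarrow> 'a \<Rightarrow> 'a" where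
  "hat G = (THE f. algebra_automorphism G f \<and> (\<forall>a\<in>{1..dimn G}. f (gen G a) = - gen G a))"

text \<open>The even (\<open>k = 0\<close>) and odd (\<open>k = 1\<close>) subspaces.\<close>

definition parity_part :: "('f::field, 'a::ring_1, 'm) geom_alg_scheme \<Rightarrow> nat \<Rightarrow> 'a set" where
  "parity_part G k = {U. hat G U = (- 1) ^ k * U}"

definition Lam :: "('f::field, 'a::ring_1, 'm) geom_alg_scheme \<Rightarrow> 'a set" where
  "Lam G = generated_subalgebra G (gen G ` {pnum G + qnum G + 1..dimn G})"

definition Lam_even :: "('f::field, 'a::ring_1, 'm) geom_alg_scheme \<Rightarrow> 'a set" where
  "Lam_even G = Lam G \<inter> parity_part G 0"

definition left_ideal :: "'a::ring_1 set \<Rightarrow> bool" where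
  "left_ideal I \<longleftrightarrow>
    0 \<in> I \<and> (\<forall>x\<in>I. \<forall>y\<in>I. x + y \<in> I) \<and> (\<forall>a. \<forall>x\<in>I. a * x \<in> I)"

definition maximal_left_ideal :: "'a::ring_1 set \<Rightarrow> bool" where
  "maximal_left_ideal M \<longleftrightarrow>
    left_ideal M \<and> M \<noteq> UNIV \<and> (\<forall>I. left_ideal I \<and> M \<subseteq> I \<longrightarrow> I = M \<or> I = UNIV)"

definition jacobson_radical :: "'a::ring_1 set" where
  "jacobson_radical = \<Inter> {M. maximal_left_ideal M}"

definition rad_even :: "('f::field, 'a::ring_1, 'm) geom_alg_scheme \<Rightarrow> 'a set" where
  "rad_even G = jacobson_radical \<inter> parity_part G 0"

definition invertibles :: "'a::ring_1 set \<Rightarrow> 'a set"  ("_\<^sup>\<times>" [1000] 1000) where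
  "A\<^sup>\<times> = {x \<in> A. \<exists>y. x * y = 1 \<and> y * x = 1}"

definition ring_inv :: "'a::ring_1 \<Rightarrow> 'a" where
  "ring_inv x = (THE y. x * y = 1 \<and> y * x = 1)"

definition center :: "'a::ring_1 set" where
  "center = {z. \<forall>x. z * x = x * z}"

definition S_space :: "('f::field, 'a::ring_1, 'm) geom_alg_scheme \<Rightarrow> 'a set" where
  "S_space G = (if odd (dimn G) then grade G 0 + grade G (dimn G) else grade G 0)"

definition P_pm :: "('f::field, 'a::ring_1, 'm) geom_alg_scheme \<Rightarrow> 'a set" where
  "P_pm G = (parity_part G 0)\<^sup>\<times> \<union> (parity_part G 1)\<^sup>\<times>"

definition P_group :: "('f::field, 'a::ring_1, 'm) geom_alg_scheme \<Rightarrow> 'a set" where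
  "P_group G = P_pm G * center\<^sup>\<times>"

definition ker_ad :: "'a::ring_1 set" where
  "ker_ad = {T \<in> UNIV\<^sup>\<times>. \<forall>U. T * U * ring_inv T = U}"

definition ker_ad_check :: "('f::field, 'a::ring_1, 'm) geom_alg_scheme \<Rightarrow> 'a set" where
  "ker_ad_check G = {T \<in> UNIV\<^sup>\<times>. \<forall>U. hat G T * U * ring_inv T = U}"

end

theory Submission
  imports Defs
begin

text \<open>
  Write \<open>S = hat (T\<inverse>) * T\<close> for a unit \<open>T\<close>; then \<open>T = hat T * S\<close> and \<open>hat S * S = 1\<close>, and \<open>T\<close> is
  homogeneous iff \<open>S = 1\<close> or \<open>S = - 1\<close>.  If \<open>S = c + y\<close> with \<open>y\<close> even in the radical, then
  \<open>S * S = 1\<close>; modulo the radical \<open>c * c = 1\<close>, and \<open>y * (2 * c + y) = 0\<close> with \<open>2 * c + y\<close> a unit, so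
  \<open>y = 0\<close>.  For odd \<open>n\<close> the top blade \<open>E\<close> is central and odd; the same argument reduces
  \<open>S = a + b * E + y\<close> to \<open>S = a + b * E\<close>, and then \<open>T + hat T\<close> or \<open>T - hat T\<close> is a homogeneous unit which
  differs from \<open>T\<close> by a unit of the form \<open>c + d * E\<close>.  For even \<open>n\<close> without null generators \<open>E\<close> anticommutes
  with odd elements, which excludes a nonzero \<open>E\<close>-part of \<open>S\<close>.  The remaining definitions are
  sandwiched between these, because the center lies in the sum of \<open>G\<^sup>0\<close> (or \<open>G\<^sup>0\<^sup>n\<close>) and the radical.
\<close>

section \<open>The Jacobson radical and units of a ring\<close>

text \<open>Zorn's lemma applies because a left ideal is proper exactly when it misses 1, and
  missing 1 survives unions of chains.\<close>

lemma maximal_left_ideal_exists: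
  fixes I :: "'a::ring_1 set"
  assumes "left_ideal I" "1 \<notin> I"
  shows "\<exists>M. maximal_left_ideal M \<and> I \<subseteq> M"
proof -
  have proper: "J = UNIV \<longleftrightarrow> 1 \<in> J" if "left_ideal J" for J :: "'a set"
    using that unfolding left_ideal_def by (metis UNIV_I UNIV_eq_I mult.right_neutral)
  let ?A = "{J. left_ideal J \<and> I \<subseteq> J \<and> 1 \<notin> J}"
  have "\<exists>M\<in>?A. \<forall>X\<in>?A. M \<subseteq> X \<longrightarrow> X = M"
  proof (rule subset_Zorn_nonempty)
    show "?A \<noteq> {}" using assms by auto
    fix C assume C: "C \<noteq> {}" "subset.chain ?A C"
    have sub: "C \<subseteq> ?A" and lin: "\<And>X Y. X \<in> C \<Longrightarrow> Y \<in> C \<Longrightarrow> X \<subseteq> Y \<or> Y \<subseteq> X"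
      using C(2) by (auto simp: subset.chain_def)
    have "x + y \<in> \<Union>C" if xy: "x \<in> \<Union>C" "y \<in> \<Union>C" for x y
    proof -
      from xy obtain X Y where XY: "X \<in> C" "Y \<in> C" "x \<in> X" "y \<in> Y" by auto
      then have "left_ideal X" "left_ideal Y" using sub by auto
      with XY lin[OF XY(1,2)] show ?thesis
        unfolding left_ideal_def by (meson UnionI subsetD)
    qed
    moreover have "0 \<in> \<Union>C" "\<And>a x. x \<in> \<Union>C \<Longrightarrow> a * x \<in> \<Union>C"
      using C(1) sub unfolding left_ideal_def by blast+
    ultimately have "left_ideal (\<Union>C)" by (simp add: left_ideal_def)
    then show "\<Union>C \<in> ?A" using C(1) sub by auto
  qed
  then obtain M where M: "M \<in> ?A" "\<And>X. X \<in> ?A \<Longrightarrow> M \<subseteq> X \<Longrightarrow> X = M" by auto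
  have "maximal_left_ideal M"
    unfolding maximal_left_ideal_def using M proper by blast
  with M show ?thesis by auto
qed

lemma left_ideal_jacobson: "left_ideal (jacobson_radical :: 'a::ring_1 set)"
  by (auto simp: jacobson_radical_def left_ideal_def maximal_left_ideal_def)

lemma left_ideal_minus: "left_ideal I \<Longrightarrow> x \<in> I \<Longrightarrow> - x \<in> I"
  unfolding left_ideal_def by (metis mult_minus1)

text \<open>If 1 + x had no left inverse, its left multiples would form a proper left ideal inside
  some maximal one. That ideal also contains x, hence 1.\<close>

lemma jacobson_left_inverse:
  fixes x :: "'a::ring_1"
  assumes "x \<in> jacobson_radical"
  shows "\<exists>y. y * (1 + x) = 1"
proof (rule ccontr)
  let ?I = "range (\<lambda>y. y * (1 + x))"
  assume "\<not> ?thesis"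
  then have "1 \<notin> ?I" by (metis rangeE)
  moreover have "left_ideal ?I"
    unfolding left_ideal_def
  proof (intro conjI ballI allI)
    show "0 \<in> ?I" by (rule range_eqI[of _ _ 0]) simp
  next
    fix u v assume "u \<in> ?I" "v \<in> ?I"
    then show "u + v \<in> ?I" by (auto simp: distrib_right[symmetric])
  next
    fix a u assume "u \<in> ?I"
    then show "a * u \<in> ?I" by (auto simp: mult.assoc[symmetric])
  qed
  ultimately obtain M where M: "maximal_left_ideal M" "?I \<subseteq> M"
    using maximal_left_ideal_exists by blast
  have "1 * (1 + x) \<in> M" using M(2) by blast
  moreover have "x \<in> M" using assms M(1) by (auto simp: jacobson_radical_def)
  moreover have L: "left_ideal M" using M(1) by (simp add: maximal_left_ideal_def)
  ultimately have "(1 + x) + - x \<in> M"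
    using left_ideal_minus[OF L] unfolding left_ideal_def by (metis mult_1)
  then have "1 \<in> M" by simp
  then have "M = UNIV" using L unfolding left_ideal_def by (metis UNIV_eq_I mult.right_neutral)
  with M(1) show False by (simp add: maximal_left_ideal_def)
qed

lemma one_notin_jacobson: "(1::'a::ring_1) \<notin> jacobson_radical"
proof
  assume "(1::'a) \<in> jacobson_radical"
  then have "(- 1::'a) \<in> jacobson_radical" by (rule left_ideal_minus[OF left_ideal_jacobson])
  from jacobson_left_inverse[OF this] show False by simp
qed

text \<open>If x lies outside a maximal left ideal M, then 1 = m + y x for some m in M. Since y x
  squares to zero, m = 1 - y x is inverted by 1 + y x, so M would contain a unit.\<close>

lemma square_zero_in_jacobson:
  fixes x :: "'a::ring_1"
  assumes sq: "\<And>y. y * x * (y * x) = 0"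
  shows "x \<in> jacobson_radical"
  unfolding jacobson_radical_def
proof (clarify, rule ccontr)
  fix M :: "'a set" assume M: "maximal_left_ideal M" and x: "x \<notin> M"
  have L: "left_ideal M" using M by (simp add: maximal_left_ideal_def)
  let ?I = "{m + y * x | m y. m \<in> M}"
  have "left_ideal ?I"
    unfolding left_ideal_def
  proof (intro conjI ballI allI)
    show "0 \<in> ?I" using L unfolding left_ideal_def by (auto intro!: exI[of _ 0])
  next
    fix u v assume "u \<in> ?I" "v \<in> ?I"
    then obtain m y m' y' where "u = m + y * x" "v = m' + y' * x" "m \<in> M" "m' \<in> M" by auto
    then have "u + v = (m + m') + (y + y') * x" "m + m' \<in> M"
      using L by (auto simp: algebra_simps left_ideal_def)
    then show "u + v \<in> ?I" by blast
  next
    fix a u assume "u \<in> ?I"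
    then obtain m y where "u = m + y * x" "m \<in> M" by auto
    then have "a * u = a * m + (a * y) * x" "a * m \<in> M"
      using L by (auto simp: algebra_simps left_ideal_def)
    then show "a * u \<in> ?I" by blast
  qed
  moreover have "M \<subseteq> ?I"
  proof
    fix m assume "m \<in> M"
    then have "m = m + 0 * x \<and> m \<in> M" by simp
    then show "m \<in> ?I" by blast
  qed
  moreover have "x \<in> ?I"
  proof -
    have "x = 0 + 1 * x \<and> 0 \<in> M" using L by (simp add: left_ideal_def)
    then show ?thesis by blast
  qed
  ultimately have "?I = UNIV" using M x unfolding maximal_left_ideal_def by blast
  then obtain m y where my: "1 = m + y * x" "m \<in> M" by blast
  then have m: "m = 1 - y * x" by (simp add: algebra_simps)
  have "(1 + y * x) * m = 1" by (simp add: m algebra_simps sq[unfolded mult.assoc])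
  moreover have "(1 + y * x) * m \<in> M" using my(2) L by (auto simp: left_ideal_def)
  ultimately have "1 \<in> M" by simp
  then have "M = UNIV" using L unfolding left_ideal_def by (metis UNIV_eq_I mult.right_neutral)
  with M show False by (simp add: maximal_left_ideal_def)
qed

text \<open>Right multiplication by a unit permutes the maximal left ideals.\<close>

lemma jacobson_mult_unit:
  fixes x :: "'a::ring_1"
  assumes x: "x \<in> jacobson_radical" and uv: "u * v = 1" "v * u = 1"
  shows "x * u \<in> jacobson_radical"
  unfolding jacobson_radical_def
proof clarify
  fix M :: "'a set" assume M: "maximal_left_ideal M"
  define pre where "pre w I = {y. y * w \<in> I}" for w and I :: "'a set"
  have pre_ideal: "left_ideal (pre w I)" if "left_ideal I" for w I
    using that by (auto simp: left_ideal_def pre_def algebra_simps)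
  have pre_pre: "pre v (pre u I) = I" "pre u (pre v I) = I" for I
    using uv by (auto simp: pre_def mult.assoc)
  have pre_mono: "pre w I \<subseteq> pre w J" if "I \<subseteq> J" for w I J
    using that by (auto simp: pre_def)
  have pre_UNIV: "pre w UNIV = UNIV" for w by (auto simp: pre_def)
  have "maximal_left_ideal (pre u M)"
    unfolding maximal_left_ideal_def
  proof (intro conjI allI impI)
    show "left_ideal (pre u M)" using M pre_ideal by (simp add: maximal_left_ideal_def)
    show "pre u M \<noteq> UNIV" using M pre_pre pre_UNIV unfolding maximal_left_ideal_def by metis
    fix I assume I: "left_ideal I \<and> pre u M \<subseteq> I"
    then have "left_ideal (pre v I)" "M \<subseteq> pre v I"
      using pre_ideal pre_mono[of "pre u M" I v] pre_pre by auto
    then have "pre v I = M \<or> pre v I = UNIV" using M by (auto simp: maximal_left_ideal_def)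
    then show "I = pre u M \<or> I = UNIV" using pre_pre pre_UNIV by metis
  qed
  then have "x \<in> pre u M" using x by (auto simp: jacobson_radical_def)
  then show "x * u \<in> M" by (simp add: pre_def)
qed

section \<open>Units and their inverses\<close>

lemma mem_invertibles: "x \<in> A\<^sup>\<times> \<longleftrightarrow> x \<in> A \<and> (\<exists>y. x * y = 1 \<and> y * x = 1)"
  by (simp add: invertibles_def)

lemma ring_inv_eqI:
  fixes x :: "'a::ring_1"
  assumes "x * y = 1" "y * x = 1"
  shows "ring_inv x = y"
  unfolding ring_inv_def using assms by (metis (mono_tags, lifting) mult.assoc mult.right_neutral mult_1 the_equality)

lemma
  fixes x :: "'a::ring_1"
  assumes "x \<in> A\<^sup>\<times>"
  shows ring_inv_right: "x * ring_inv x = 1" and ring_inv_left: "ring_inv x * x = 1"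
  using assms ring_inv_eqI by (auto simp: mem_invertibles)

lemma ring_inv_unit: "x \<in> A\<^sup>\<times> \<Longrightarrow> ring_inv x \<in> UNIV\<^sup>\<times>"
  unfolding mem_invertibles[of "ring_inv x"] using ring_inv_left ring_inv_right by blast

lemma unit_mult:
  fixes x y :: "'a::ring_1"
  assumes "x \<in> UNIV\<^sup>\<times>" "y \<in> UNIV\<^sup>\<times>"
  shows "x * y \<in> UNIV\<^sup>\<times>"
proof -
  have "x * y * (ring_inv y * ring_inv x) = x * (y * ring_inv y) * ring_inv x"
    "ring_inv y * ring_inv x * (x * y) = ring_inv y * (ring_inv x * x) * y"
    by (simp_all add: mult.assoc)
  then show ?thesis
    using assms by (auto simp: mem_invertibles ring_inv_right[OF assms(1)] ring_inv_right[OF assms(2)]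
      ring_inv_left[OF assms(1)] ring_inv_left[OF assms(2)])
qed

lemma invertibles_mono: "A \<subseteq> B \<Longrightarrow> A\<^sup>\<times> \<subseteq> B\<^sup>\<times>"
  by (auto simp: mem_invertibles)

lemma invertibles_iff: "x \<in> A\<^sup>\<times> \<longleftrightarrow> x \<in> A \<and> x \<in> UNIV\<^sup>\<times>"
  by (auto simp: mem_invertibles)

lemma ker_ad_eq_center: "(ker_ad :: 'a::ring_1 set) = center\<^sup>\<times>"
proof -
  have "(\<forall>U. T * U * ring_inv T = U) \<longleftrightarrow> T \<in> center" if "T \<in> UNIV\<^sup>\<times>" for T :: 'a
    unfolding center_def mem_Collect_eq
    by (intro all_cong1) (metis mult.assoc mult.right_neutral ring_inv_left[OF that] ring_inv_right[OF that])
  then show ?thesis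
    unfolding ker_ad_def set_eq_iff invertibles_iff[of _ center] by blast
qed

section \<open>Blades\<close>

text \<open>Excludes characteristic 2: if 2 = 0, additivity gives 2 * \<open>\<phi> 1\<close> = 0 in
  characteristic zero, so 0 and 1 have the same image.\<close>

lemma field_iso_two_neq_0:
  fixes \<phi> :: "'f::field \<Rightarrow> 'k::field_char_0"
  assumes "field_iso \<phi>"
  shows "(2::'f) \<noteq> 0"
proof
  assume two: "(2::'f) = 0"
  have inj: "inj \<phi>" and add: "\<And>x y. \<phi> (x + y) = \<phi> x + \<phi> y"
    using assms by (auto simp: field_iso_def bij_def)
  have "\<phi> 0 + \<phi> 0 = \<phi> 0" using add[of 0 0] by simp
  then have zero: "\<phi> 0 = 0" by simp
  have "\<phi> 1 + \<phi> 1 = \<phi> 0" using add[of 1 1] two by simp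
  then have "2 * \<phi> 1 = 0" using zero by simp
  then have "\<phi> 1 = \<phi> 0" using zero by simp
  with inj show False by (simp add: inj_eq)
qed

text \<open>The symmetric difference with \<open>{a}\<close>. Multiplying a blade by
  \<open>gen G a\<close> changes its index set in this way, up to a scalar factor.\<close>

definition toggle :: "'b \<Rightarrow> 'b set \<Rightarrow> 'b set" where
  "toggle a A = (if a \<in> A then A - {a} else insert a A)"

lemma toggle_toggle [simp]: "toggle a (toggle a A) = A"
  by (auto simp: toggle_def)

lemma toggle_eq_iff [simp]: "toggle a A = toggle a B \<longleftrightarrow> A = B"
  by (metis toggle_toggle)

lemma toggle_subset: "a \<in> N \<Longrightarrow> A \<subseteq> N \<Longrightarrow> toggle a A \<subseteq> N"
  by (auto simp: toggle_def)

lemma toggle_insert: "a \<noteq> b \<Longrightarrow> toggle a (insert b A) = insert b (toggle a A)"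
  by (auto simp: toggle_def)

context geometric_algebra
begin

definition N :: "nat set" where "N = {1..dimn G}"

lemma finite_N [simp]: "finite N" and card_N [simp]: "card N = dimn G"
  by (simp_all add: N_def)

lemma finite_index: "A \<subseteq> N \<Longrightarrow> finite A"
  using finite_subset finite_N by blast

lemma two_neq_0: "(2::'f) \<noteq> 0"
  using scalars_relations
proof
  assume "(\<exists>\<phi> :: 'f \<Rightarrow> real. field_iso \<phi>) \<and> clifford_relations G (- 1)"
  then show ?thesis using field_iso_two_neq_0 by blast
next
  assume "(\<exists>\<phi> :: 'f \<Rightarrow> complex. field_iso \<phi>) \<and> clifford_relations G 1"
  then show ?thesis using field_iso_two_neq_0 by blast
qed

lemma eq_minus_iff: "t = - t \<longleftrightarrow> (t::'f) = 0"
proof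
  assume "t = - t"
  then have "2 * t = 0" by (simp add: eq_neg_iff_add_eq_0)
  then show "t = 0" using two_neq_0 by simp
qed simp

lemma add_self: "(x::'a) + x = scal G 2 x"
proof -
  have "scal G 2 x = scal G (1 + 1) x" by simp
  then show ?thesis by (simp only: scale_left_distrib scale_one)
qed

lemma gen_anticommute: "a \<in> N \<Longrightarrow> b \<in> N \<Longrightarrow> a \<noteq> b \<Longrightarrow> gen G a * gen G b = - (gen G b * gen G a)"
  using scalars_relations
  by (auto simp: clifford_relations_def eta_def eq_neg_iff_add_eq_0 N_def)

lemma gen_square:
  assumes "a \<in> N"
  obtains c where "gen G a * gen G a = scal G c 1" "c \<noteq> 0 \<longleftrightarrow> a \<le> pnum G + qnum G"
proof -
  \<comment> \<open>The real and the complex case are merged here: s is -1 or 1, and the fact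
    retained about it is that it is nonzero.\<close>
  obtain s where s: "s \<noteq> 0" "clifford_relations G s"
    using scalars_relations by (metis one_neq_zero neg_equal_0_iff_equal)
  let ?c = "eta s (pnum G) (qnum G) a a"
  have "gen G a * gen G a + gen G a * gen G a = scal G (2 * ?c) 1"
    using s(2) assms by (simp add: clifford_relations_def N_def)
  then have "scal G 2 (gen G a * gen G a) = scal G 2 (scal G ?c 1)" by (simp add: add_self)
  then have "gen G a * gen G a = scal G ?c 1"
    by (simp only: scale_cancel_left two_neq_0) auto
  moreover have "?c \<noteq> 0 \<longleftrightarrow> a \<le> pnum G + qnum G"
    using s(1) by (auto simp: eta_def)
  ultimately show ?thesis by (rule that)
qed

lemma null_gen_square: "a \<in> N \<Longrightarrow> \<not> a \<le> pnum G + qnum G \<Longrightarrow> gen G a * gen G a = 0"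
  using gen_square by (metis scale_zero_left)

lemma subalgebra_Collect:
  assumes "P 1" "\<And>c x. P x \<Longrightarrow> P (scal G c x)" "\<And>x y. P x \<Longrightarrow> P y \<Longrightarrow> P (x + y)"
    "\<And>x y. P x \<Longrightarrow> P y \<Longrightarrow> P (x * y)"
  shows "subalgebra G (Collect P)"
proof -
  have "P 0" using assms(2)[OF assms(1), of 0] by simp
  then show ?thesis using assms by (auto simp: subalgebra_def subspace_def)
qed

text \<open>The elements satisfying P form a subalgebra containing the generators, hence containing
  the subalgebra they generate.\<close>

lemma generated_induct [consumes 1, case_names one scal add mult gen]:
  assumes "x \<in> generated_subalgebra G X"
    and "P 1" "\<And>c x. P x \<Longrightarrow> P (scal G c x)" "\<And>x y. P x \<Longrightarrow> P y \<Longrightarrow> P (x + y)"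
    "\<And>x y. P x \<Longrightarrow> P y \<Longrightarrow> P (x * y)" "\<And>x. x \<in> X \<Longrightarrow> P x"
  shows "P x"
proof -
  have "subalgebra G (Collect P)" using assms(2-5) by (rule subalgebra_Collect)
  then have "generated_subalgebra G X \<subseteq> Collect P"
    using assms(6) by (auto simp: generated_subalgebra_def)
  then show ?thesis using assms(1) by auto
qed

lemma generated_N: "generated_subalgebra G (gen G ` N) = UNIV"
  unfolding N_def by (rule generated)

lemma algebra_induct [case_names one scal add mult gen]:
  assumes "P 1" "\<And>c x. P x \<Longrightarrow> P (scal G c x)" "\<And>x y. P x \<Longrightarrow> P y \<Longrightarrow> P (x + y)"
    "\<And>x y. P x \<Longrightarrow> P y \<Longrightarrow> P (x * y)" "\<And>a. a \<in> N \<Longrightarrow> P (gen G a)"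
  shows "P x"
  using assms by (intro generated_induct[of x "gen G ` N" P]) (auto simp: generated_N)

lemma blade_empty [simp]: "blade G {} = 1"
  by (simp add: blade_def)

lemma blade_insert_less:
  assumes "finite A" "\<And>b. b \<in> A \<Longrightarrow> a < b"
  shows "blade G (insert a A) = gen G a * blade G A"
proof -
  have "a \<notin> A" using assms(2) by blast
  then have "sorted_list_of_set (insert a A) = insort a (sorted_list_of_set A)"
    using assms(1) by simp
  also have "\<dots> = a # sorted_list_of_set A"
    using assms by (intro insort_is_Cons) (auto intro: less_imp_le)
  finally show ?thesis by (simp add: blade_def)
qed

lemma blade_insert_less_N:
  "A \<subseteq> N \<Longrightarrow> (\<And>b. b \<in> A \<Longrightarrow> a < b) \<Longrightarrow> blade G (insert a A) = gen G a * blade G A"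
  by (intro blade_insert_less finite_subset[of A N]) auto

text \<open>Induction on A by its least index b. If a < b, the generator is simply put in front; if
  a = b, its square is a scalar; if a > b, it anticommutes past b and the induction hypothesis
  applies. The scalar can vanish only when a null generator meets itself.\<close>

lemma gen_mult_blade_ex:
  assumes "A \<subseteq> N" "a \<in> N"
  shows "\<exists>k. gen G a * blade G A = scal G k (blade G (toggle a A)) \<and>
    (a \<notin> A \<or> a \<le> pnum G + qnum G \<longrightarrow> k \<noteq> 0)"
proof -
  have "finite A" using assms(1) by (rule finite_index)
  then show ?thesis using assms(1)
  proof (induction A rule: finite_linorder_min_induct)
    case empty
    then show ?case
      using blade_insert_less[of "{}" a] by (auto simp: toggle_def intro!: exI[of _ 1])
  next
    case (insert b A)
    have b: "b \<in> N" "A \<subseteq> N" using insert.prems by auto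
    have bA: "blade G (insert b A) = gen G b * blade G A"
      using insert.hyps by (intro blade_insert_less) auto
    consider "a < b" | "a = b" | "b < a" by linarith
    then show ?case
    proof cases
      case 1
      then have "toggle a (insert b A) = insert a (insert b A)"
        using insert.hyps by (auto simp: toggle_def)
      moreover have "blade G (insert a (insert b A)) = gen G a * blade G (insert b A)"
        using 1 insert.hyps by (intro blade_insert_less) auto
      ultimately show ?thesis by (auto intro!: exI[of _ 1])
    next
      case 2
      obtain c where c: "gen G a * gen G a = scal G c 1" "c \<noteq> 0 \<longleftrightarrow> a \<le> pnum G + qnum G"
        using gen_square assms(2) by blast
      have "b \<notin> A" using insert.hyps by auto
      then have "toggle a (insert b A) = A" using 2 by (auto simp: toggle_def)
      moreover have "gen G a * blade G (insert b A) = scal G c (blade G A)"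
        unfolding bA using 2 c(1) by (simp add: mult.assoc[symmetric] scal_mult_left)
      ultimately show ?thesis using c(2) 2 by auto
    next
      case 3
      obtain k where k: "gen G a * blade G A = scal G k (blade G (toggle a A))"
        "a \<notin> A \<or> a \<le> pnum G + qnum G \<longrightarrow> k \<noteq> 0"
        using insert.IH b(2) by blast
      have "gen G a * blade G (insert b A) = - (gen G b * (gen G a * blade G A))"
        unfolding bA using gen_anticommute[OF assms(2) b(1)] 3
        by (simp add: mult.assoc[symmetric])
      also have "\<dots> = scal G (- k) (gen G b * blade G (toggle a A))"
        by (simp add: k scal_mult_right)
      also have "gen G b * blade G (toggle a A) = blade G (insert b (toggle a A))"
        using 3 insert.hyps b assms(2)
        by (intro blade_insert_less_N[symmetric] toggle_subset) (auto simp: toggle_def split: if_splits)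
      finally show ?thesis using k(2) 3 by (intro exI[of _ "- k"]) (auto simp: toggle_insert)
    qed
  qed
qed

lemma gen_mult_blade:
  assumes "A \<subseteq> N" "a \<in> N"
  obtains k where "gen G a * blade G A = scal G k (blade G (toggle a A))"
    "a \<notin> A \<or> a \<le> pnum G + qnum G \<Longrightarrow> k \<noteq> 0"
  using gen_mult_blade_ex[OF assms] by blast

lemma blade_insert_ex:
  assumes "A \<subseteq> N" "a \<in> N" "a \<notin> A"
  obtains k where "blade G (insert a A) = scal G k (gen G a * blade G A)" "k \<noteq> 0"
proof -
  obtain k where k: "gen G a * blade G A = scal G k (blade G (toggle a A))" "k \<noteq> 0"
    using gen_mult_blade[OF assms(1,2)] assms(3) by blast
  have "toggle a A = insert a A" using assms(3) by (simp add: toggle_def)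
  then have "blade G (insert a A) = scal G (inverse k) (gen G a * blade G A)"
    using k by simp
  then show ?thesis using k(2) by (intro that[of "inverse k"]) auto
qed

lemma prod_list_mult_gen:
  assumes "a \<in> N" "set xs \<subseteq> N" "a \<notin> set xs"
  shows "prod_list (map (gen G) xs) * gen G a = (- 1) ^ length xs * (gen G a * prod_list (map (gen G) xs))"
  using assms(2,3)
proof (induction xs)
  case (Cons b xs)
  have anti: "gen G b * (gen G a * y) = - (gen G a * (gen G b * y))" for y
    using gen_anticommute[of b a] Cons.prems assms(1) by (auto simp: mult.assoc[symmetric])
  have "prod_list (map (gen G) (b # xs)) * gen G a
      = gen G b * ((- 1) ^ length xs * (gen G a * prod_list (map (gen G) xs)))"
    using Cons by (simp add: mult.assoc)
  also have "\<dots> = (- 1) ^ length (b # xs) * (gen G a * prod_list (map (gen G) (b # xs)))"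
    by (cases "even (length xs)") (simp_all add: anti)
  finally show ?case .
qed simp

text \<open>Each index other than a contributes one sign, and a commutes with itself. If a is in A,
  the blade is first rewritten, up to a scalar, with a in front.\<close>

lemma blade_mult_gen:
  assumes "A \<subseteq> N" "a \<in> N"
  shows "blade G A * gen G a = (- 1) ^ card (A - {a}) * (gen G a * blade G A)"
proof -
  have notin: "blade G B * gen G a = (- 1) ^ card B * (gen G a * blade G B)" if "B \<subseteq> N" "a \<notin> B" for B
  proof -
    have "finite B" using that(1) by (rule finite_index)
    then show ?thesis
      using prod_list_mult_gen[OF assms(2), of "sorted_list_of_set B"] that by (simp add: blade_def)
  qed
  show ?thesis
  proof (cases "a \<in> A")
    case True
    define B where "B = A - {a}"
    have B: "B \<subseteq> N" "a \<notin> B" "A = insert a B" using True assms by (auto simp: B_def)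
    obtain k where k: "blade G A = scal G k (gen G a * blade G B)"
      using blade_insert_ex[OF B(1) assms(2) B(2)] B(3) by blast
    have "blade G A * gen G a = scal G k (gen G a * (blade G B * gen G a))"
      by (simp add: k scal_mult_left mult.assoc)
    also have "\<dots> = scal G k (gen G a * ((- 1) ^ card B * (gen G a * blade G B)))"
      using notin[OF B(1,2)] by simp
    also have "\<dots> = (- 1) ^ card B * (gen G a * blade G A)"
      by (cases "even (card B)") (simp_all add: k scal_mult_right)
    finally show ?thesis by (simp add: B_def)
  qed (use notin assms in simp)
qed

section \<open>The blade basis and its coordinates\<close>

definition blades :: "'a set" where "blades = blade G ` Pow N"

text \<open>The span contains 1 and is closed under left multiplication by the generators, hence by
  every element of the algebra.\<close>

lemma span_blades: "span blades = UNIV"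
proof -
  have "\<forall>w\<in>span blades. x * w \<in> span blades" for x
  proof (induction x rule: algebra_induct)
    case (gen a)
    show ?case
    proof
      fix w assume "w \<in> span blades"
      then show "gen G a * w \<in> span blades"
      proof (induction rule: span_induct_alt)
        case (step c x y)
        obtain A where A: "A \<subseteq> N" "x = blade G A" using step by (auto simp: blades_def)
        obtain k where "gen G a * x = scal G k (blade G (toggle a A))"
          using gen_mult_blade[OF A(1) gen] A(2) by blast
        moreover have "blade G (toggle a A) \<in> blades"
          using toggle_subset[OF gen A(1)] by (auto simp: blades_def)
        ultimately have "gen G a * x \<in> span blades" by (simp add: span_scale span_base)
        then show ?case using step by (simp add: distrib_left scal_mult_right span_add span_scale)
      qed (simp add: span_zero)
    qed
  qed (auto simp: distrib_right scal_mult_left mult.assoc span_add span_scale)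
  moreover have "blade G {} \<in> span blades" unfolding blades_def by (intro span_base imageI) auto
  ultimately show ?thesis by (metis UNIV_eq_I blade_empty mult.right_neutral)
qed

lemma
  shows inj_blade: "inj_on (blade G) (Pow N)" and independent_blades: "independent blades"
proof -
  have fin: "finite blades" by (simp add: blades_def)
  have le: "2 ^ dimn G \<le> card B" if "finite B" "span B = UNIV" for B
    using dim_le_card[of UNIV B] that dimension by simp
  have card: "card (Pow N) = 2 ^ dimn G" by (simp add: card_Pow)
  have le2: "card blades \<le> 2 ^ dimn G"
    unfolding blades_def using card_image_le[of "Pow N" "blade G"] card by simp
  then have eq: "card blades = card (Pow N)"
    using le[OF fin span_blades] card by simp
  show "inj_on (blade G) (Pow N)"
    using eq unfolding blades_def by (intro eq_card_imp_inj_on) auto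
  show "independent blades"
  proof (rule ccontr)
    assume "\<not> independent blades"
    then obtain x where x: "x \<in> blades" "x \<in> span (blades - {x})" by (auto simp: dependent_def)
    then have "span (blades - {x}) = UNIV" using span_redundant[of x "blades - {x}"] span_blades
      by (simp add: insert_absorb)
    then have "2 ^ dimn G \<le> card (blades - {x})" using le fin by blast
    also have "\<dots> < card blades" using x(1) fin by (intro card_Diff1_less) auto
    finally show False using le2 by simp
  qed
qed

lemma blade_induct [case_names zero step]:
  assumes "P 0" "\<And>c A y. A \<subseteq> N \<Longrightarrow> P y \<Longrightarrow> P (scal G c (blade G A) + y)"
  shows "P x"
  using assms span_blades by (intro span_induct_alt[of x blades P]) (auto simp: blades_def)

definition cf :: "nat set \<Rightarrow> 'a \<Rightarrow> 'f" where
  "cf A x = representation blades x (blade G A)"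

lemma cf_add [simp]: "cf A (x + y) = cf A x + cf A y"
  by (simp add: cf_def representation_add independent_blades span_blades)

lemma cf_scal [simp]: "cf A (scal G c x) = c * cf A x"
  by (simp add: cf_def representation_scale independent_blades span_blades)

lemma cf_zero [simp]: "cf A 0 = 0"
  using cf_scal[of A 0 0] by simp

lemma cf_minus [simp]: "cf A (- x) = - cf A x"
  using cf_scal[of A "- 1" x] by simp

lemma cf_diff [simp]: "cf A (x - y) = cf A x - cf A y"
  using cf_add[of A x "- y"] by simp

lemma cf_blade: "A \<subseteq> N \<Longrightarrow> B \<subseteq> N \<Longrightarrow> cf A (blade G B) = (if A = B then 1 else 0)"
proof -
  assume AB: "A \<subseteq> N" "B \<subseteq> N"
  then have "blade G A = blade G B \<longleftrightarrow> A = B" using inj_blade by (auto simp: inj_on_def)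
  moreover have "blade G B \<in> blades" using AB by (simp add: blades_def)
  ultimately show ?thesis by (simp add: cf_def representation_basis independent_blades)
qed

lemma cf_one: "A \<subseteq> N \<Longrightarrow> cf A 1 = (if A = {} then 1 else 0)"
  using cf_blade[of A "{}"] by simp

lemma cf_expansion: "x = (\<Sum>A\<in>Pow N. scal G (cf A x) (blade G A))"
proof (induction x rule: blade_induct)
  case (step c A y)
  have "(\<Sum>B\<in>Pow N. scal G (cf B (scal G c (blade G A) + y)) (blade G B))
    = (\<Sum>B\<in>Pow N. scal G (if A = B then c else 0) (blade G B)) + (\<Sum>B\<in>Pow N. scal G (cf B y) (blade G B))"
    using step(1) by (auto simp: sum.distrib[symmetric] scale_left_distrib cf_blade intro!: sum.cong)
  also have "(\<Sum>B\<in>Pow N. scal G (if A = B then c else 0) (blade G B)) = scal G c (blade G A)"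
    using step(1) by (simp add: if_distrib[of "\<lambda>t. scal G t _"] if_distribR sum.delta cong: if_cong)
  finally show ?case using step(2) by simp
qed simp

lemma cf_ext: "(\<And>A. A \<subseteq> N \<Longrightarrow> cf A x = cf A y) \<Longrightarrow> x = y"
  by (subst (1 2) cf_expansion) (auto intro!: sum.cong)

text \<open>Since \<open>toggle a\<close> is injective, only the coordinate at A contributes at
  \<open>toggle a A\<close>. The same k serves multiplication from both sides, so commutators and
  anticommutators with a generator can be read off coordinatewise.\<close>

lemma cf_gen_mult:
  assumes A: "A \<subseteq> N" and a: "a \<in> N" and ok: "a \<notin> A \<or> a \<le> pnum G + qnum G"
  obtains k where "k \<noteq> 0" "\<And>x. cf (toggle a A) (gen G a * x) = k * cf A x"
    "\<And>x. cf (toggle a A) (x * gen G a) = (- 1) ^ card (A - {a}) * k * cf A x"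
proof -
  obtain k where k: "gen G a * blade G A = scal G k (blade G (toggle a A))" "k \<noteq> 0"
    using gen_mult_blade[OF A a] ok by blast
  have tA: "toggle a A \<subseteq> N" using toggle_subset[OF a A] .
  have left: "cf (toggle a A) (gen G a * blade G B) = (if A = B then k else 0)" if B: "B \<subseteq> N" for B
  proof (cases "A = B")
    case False
    obtain l where "gen G a * blade G B = scal G l (blade G (toggle a B))"
      using gen_mult_blade[OF B a] by blast
    then show ?thesis using B False tA toggle_subset[OF a B] by (simp add: cf_blade)
  qed (use k tA in \<open>auto simp: cf_blade\<close>)
  have sgn: "cf C ((- 1) ^ m * y) = (- 1) ^ m * cf C y" for C m y
    by (cases "even m") simp_all
  show ?thesis
  proof (rule that[OF k(2)])
    fix x show "cf (toggle a A) (gen G a * x) = k * cf A x"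
      using A by (induction x rule: blade_induct)
        (auto simp: distrib_left scal_mult_right left cf_blade)
  next
    fix x show "cf (toggle a A) (x * gen G a) = (- 1) ^ card (A - {a}) * k * cf A x"
      using A a by (induction x rule: blade_induct)
        (auto simp: distrib_left distrib_right scal_mult_left blade_mult_gen sgn left cf_blade)
  qed
qed

section \<open>Grade involution\<close>

text \<open>The candidate multiplies each blade coordinate by the sign of its grade.
  Multiplicativity needs checking only for a generator as left factor, since the admissible left
  factors form a subalgebra; being its own inverse, the map is bijective.\<close>

lemma hat_exists: "\<exists>f. algebra_automorphism G f \<and> (\<forall>a\<in>N. f (gen G a) = - gen G a)"
proof -
  define f where "f x = (\<Sum>A\<in>Pow N. scal G ((- 1) ^ card A * cf A x) (blade G A))" for x
  have add: "f (x + y) = f x + f y" for x y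
    by (simp add: f_def sum.distrib[symmetric] scale_left_distrib algebra_simps)
  have scal: "f (scal G c x) = scal G c (f x)" for c x
    by (simp add: f_def scale_sum_right algebra_simps)
  have zero: "f 0 = 0" by (simp add: f_def)
  have blade: "f (blade G A) = scal G ((- 1) ^ card A) (blade G A)" if "A \<subseteq> N" for A
  proof -
    have "f (blade G A) = (\<Sum>B\<in>Pow N. if A = B then scal G ((- 1) ^ card A) (blade G A) else 0)"
      unfolding f_def using that by (intro sum.cong) (auto simp: cf_blade)
    then show ?thesis using that by simp
  qed
  have one: "f 1 = 1" using blade[of "{}"] by simp
  have gen_mult: "f (gen G a * y) = - (gen G a * f y)" if a: "a \<in> N" for a y
  proof (induction y rule: blade_induct)
    case (step c A y)
    obtain k where k: "gen G a * blade G A = scal G k (blade G (toggle a A))"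
      using gen_mult_blade[OF step(1) a] by blast
    have "finite A" using step(1) by (rule finite_index)
    \<comment> \<open>Toggling changes the cardinality by exactly one, which flips the sign.\<close>
    then have "(- 1) ^ card (toggle a A) = - ((- 1 :: 'f) ^ card A)"
      by (cases "a \<in> A") (auto simp: toggle_def card_Suc_Diff1[symmetric] simp del: card_Diff_insert)
    then have "f (gen G a * blade G A) = - (gen G a * f (blade G A))"
      using step(1) toggle_subset[OF a step(1)]
      by (simp add: k scal blade scal_mult_right mult.commute)
    then show ?case using step(2) by (simp add: distrib_left scal_mult_right add scal)
  qed (simp add: zero)
  have gen: "f (gen G a) = - gen G a" if "a \<in> N" for a
    using gen_mult[OF that, of 1] one by simp
  have minus: "f (- x) = - f x" for x
    using add[of x "- x"] zero by (simp add: eq_neg_iff_add_eq_0 add.commute)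
  have mult: "\<forall>y. f (x * y) = f x * f y" for x
    by (induction x rule: algebra_induct)
      (auto simp: one gen gen_mult add scal distrib_right scal_mult_left mult.assoc)
  have "f (f x) = x" for x
    by (induction x rule: algebra_induct) (auto simp: one scal add mult gen minus)
  then have "bij f" by (metis bij_betw_def inj_on_inverseI surjI)
  then have "algebra_automorphism G f"
    using add scal one mult by (simp add: algebra_automorphism_def)
  with gen show ?thesis by blast
qed

text \<open>An automorphism is determined by its values on the generators, so the definite
  description defining \<open>hat\<close> is well formed.\<close>

lemma
  shows hat_automorphism: "algebra_automorphism G (hat G)"
    and hat_gen: "a \<in> N \<Longrightarrow> hat G (gen G a) = - gen G a"
proof -
  have "\<exists>!f. algebra_automorphism G f \<and> (\<forall>a\<in>N. f (gen G a) = - gen G a)"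
  proof (rule ex_ex1I[OF hat_exists])
    fix f g
    assume f: "algebra_automorphism G f \<and> (\<forall>a\<in>N. f (gen G a) = - gen G a)"
      and g: "algebra_automorphism G g \<and> (\<forall>a\<in>N. g (gen G a) = - gen G a)"
    have "f x = g x" for x
      using f g by (induction x rule: algebra_induct) (auto simp: algebra_automorphism_def)
    then show "f = g" by blast
  qed
  from theI'[OF this] show "algebra_automorphism G (hat G)" "a \<in> N \<Longrightarrow> hat G (gen G a) = - gen G a"
    unfolding hat_def N_def by auto
qed

lemma
  shows hat_one [simp]: "hat G 1 = 1"
    and hat_add [simp]: "hat G (x + y) = hat G x + hat G y"
    and hat_scal [simp]: "hat G (scal G c x) = scal G c (hat G x)"
    and hat_mult [simp]: "hat G (x * y) = hat G x * hat G y"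
  using hat_automorphism by (auto simp: algebra_automorphism_def)

lemma hat_zero [simp]: "hat G 0 = 0"
  using hat_add[of 0 0] by simp

lemma hat_minus [simp]: "hat G (- x) = - hat G x"
  using hat_add[of x "- x"] by (simp add: eq_neg_iff_add_eq_0 add.commute del: hat_add)

lemma hat_diff [simp]: "hat G (x - y) = hat G x - hat G y"
  using hat_add[of x "- y"] by simp

lemma hat_hat [simp]: "hat G (hat G x) = x"
  by (induction x rule: algebra_induct) (auto simp: hat_gen)

lemma hat_blade: "A \<subseteq> N \<Longrightarrow> hat G (blade G A) = (- 1) ^ card A * blade G A"
proof -
  assume "A \<subseteq> N"
  then have "finite A" by (rule finite_index)
  then show ?thesis using \<open>A \<subseteq> N\<close>
  proof (induction A rule: finite_linorder_min_induct)
    case (insert b A)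
    have "b \<notin> A" using insert.hyps by auto
    with insert show ?case
      by (cases "even (card A)") (simp_all add: blade_insert_less hat_gen)
  qed simp
qed

lemma cf_hat: "A \<subseteq> N \<Longrightarrow> cf A (hat G x) = (- 1) ^ card A * cf A x"
proof (induction x rule: blade_induct)
  case (step c B y)
  then show ?case by (cases "even (card B)") (auto simp: hat_blade cf_blade distrib_left)
qed simp

lemma
  shows parity_0: "x \<in> parity_part G 0 \<longleftrightarrow> hat G x = x"
    and parity_1: "x \<in> parity_part G 1 \<longleftrightarrow> hat G x = - x"
  by (simp_all add: parity_part_def)

lemma in_center_iff: "z \<in> center \<longleftrightarrow> (\<forall>a\<in>N. gen G a * z = z * gen G a)"
proof
  assume comm: "\<forall>a\<in>N. gen G a * z = z * gen G a"
  have "z * x = x * z" for x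
  proof (induction x rule: algebra_induct)
    case (mult x y)
    then show ?case by (metis mult.assoc)
  qed (auto simp: comm algebra_simps scal_mult_left scal_mult_right)
  then show "z \<in> center" by (simp add: center_def)
qed (auto simp: center_def)

lemma scalar_center: "scal G c 1 \<in> center"
  by (simp add: in_center_iff scal_mult_left scal_mult_right)

lemma center_add: "x \<in> center \<Longrightarrow> y \<in> center \<Longrightarrow> x + y \<in> center"
  by (simp add: center_def algebra_simps)

lemma center_scal: "x \<in> center \<Longrightarrow> scal G c x \<in> center"
  by (simp add: center_def scal_mult_left scal_mult_right)

lemma hat_center:
  assumes "z \<in> center"
  shows "hat G z \<in> center"
proof -
  have "hat G z * x = x * hat G z" for x
  proof -
    have "hat G (z * hat G x) = hat G (hat G x * z)" using assms by (simp add: center_def)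
    then show ?thesis by simp
  qed
  then show ?thesis by (simp add: center_def)
qed

section \<open>The extreme grades and the top blade\<close>

lemma grade_0: "grade G 0 = range (\<lambda>c. scal G c 1)"
proof -
  have "{blade G A |A. A \<subseteq> N \<and> card A = 0} = {1}"
    using finite_index by (force simp: intro: exI[of _ "{}"])
  then show ?thesis unfolding grade_def N_def[symmetric] by (simp add: span_singleton)
qed

lemma grade_top: "grade G (dimn G) = range (\<lambda>c. scal G c (blade G N))"
proof -
  have "{blade G A |A. A \<subseteq> N \<and> card A = dimn G} = {blade G N}"
    using card_subset_eq[OF finite_N] by auto
  then show ?thesis unfolding grade_def N_def[symmetric] by (simp add: span_singleton)
qed

lemma in_grade_0n: "x \<in> grade_0n G \<longleftrightarrow> (\<exists>a b. x = scal G a 1 + scal G b (blade G N))"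
  by (auto simp: grade_0n_def set_plus_def grade_0 grade_top)

lemma grade_0_subset_0n: "grade G 0 \<subseteq> grade_0n G"
proof
  fix x assume "x \<in> grade G 0"
  then obtain c where "x = scal G c 1 + scal G 0 (blade G N)" by (auto simp: grade_0)
  then show "x \<in> grade_0n G" unfolding in_grade_0n by blast
qed

lemma top_blade_comm: "a \<in> N \<Longrightarrow> blade G N * gen G a = (- 1) ^ (dimn G - 1) * (gen G a * blade G N)"
  by (simp add: blade_mult_gen)

lemma top_blade_center: "odd (dimn G) \<Longrightarrow> blade G N \<in> center"
  by (simp add: in_center_iff top_blade_comm)

lemma top_blade_twist:
  assumes "even (dimn G)"
  shows "blade G N * x = hat G x * blade G N"
proof (induction x rule: algebra_induct)
  case (mult x y)
  then show ?case by (metis hat_mult mult.assoc)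
next
  case (gen a)
  \<comment> \<open>Natural subtraction is truncated: without this, \<open>dimn G - 1\<close> could
    be 0 and the sign would be wrong.\<close>
  then have "dimn G \<noteq> 0" by (auto simp: N_def)
  then have "odd (dimn G - 1)" using assms by simp
  then show ?case using gen by (simp add: top_blade_comm hat_gen)
qed (simp_all add: algebra_simps scal_mult_left scal_mult_right)

lemma hat_top_blade: "hat G (blade G N) = (- 1) ^ dimn G * blade G N"
  by (simp add: hat_blade)

text \<open>In the square, the second copy of the least generator moves next to the first at the
  cost of a sign, and both pairs of equal factors become scalars.\<close>

lemma blade_square: "A \<subseteq> N \<Longrightarrow> \<exists>c. blade G A * blade G A = scal G c 1"
proof -
  assume A: "A \<subseteq> N"
  then have "finite A" by (rule finite_index)
  then show ?thesis using A
  proof (induction A rule: finite_linorder_min_induct)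
    case empty
    then show ?case by (auto intro: exI[of _ 1])
  next
    case (insert b A)
    then have b: "b \<in> N" "A \<subseteq> N" "b \<notin> A" by auto
    obtain d where d: "gen G b * gen G b = scal G d 1" using gen_square b(1) by blast
    obtain c where c: "blade G A * blade G A = scal G c 1" using insert b by blast
    have "blade G (insert b A) * blade G (insert b A) = gen G b * (blade G A * gen G b) * blade G A"
      using insert by (simp add: blade_insert_less mult.assoc)
    also have "\<dots> = (- 1) ^ card A * ((gen G b * gen G b) * (blade G A * blade G A))"
      using b by (cases "even (card A)") (simp_all add: blade_mult_gen mult.assoc)
    also have "\<dots> = scal G ((- 1) ^ card A * (d * c)) 1"
      by (cases "even (card A)") (simp_all add: d c scal_mult_left)
    finally show ?case by blast
  qed
qed

section \<open>Null generators and the radical\<close>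

text \<open>On another generator this is anticommutation; on the null generator itself both sides
  vanish. The relation then extends multiplicatively.\<close>

lemma null_twist:
  assumes "a \<in> N" "\<not> a \<le> pnum G + qnum G"
  shows "gen G a * x = hat G x * gen G a"
proof (induction x rule: algebra_induct)
  case (mult x y)
  then show ?case by (metis hat_mult mult.assoc)
next
  case (gen b)
  then show ?case
    using assms gen_anticommute[OF assms(1) gen] null_gen_square[OF assms]
    by (cases "a = b") (simp_all add: hat_gen)
qed (simp_all add: algebra_simps scal_mult_left scal_mult_right)

lemma null_gen_sandwich:
  assumes "a \<in> N" "\<not> a \<le> pnum G + qnum G"
  shows "gen G a * x * gen G a = 0"
  using null_twist[OF assms] null_gen_square[OF assms] by (simp add: mult.assoc)

text \<open>Every left multiple of a null generator squares to zero, because the generator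
  annihilates whatever stands between two copies of it.\<close>

lemma null_gen_jacobson:
  assumes "a \<in> N" "\<not> a \<le> pnum G + qnum G"
  shows "gen G a \<in> jacobson_radical"
proof (rule square_zero_in_jacobson)
  fix y
  have "y * gen G a * (y * gen G a) = y * (gen G a * y * gen G a)" by (simp add: mult.assoc)
  then show "y * gen G a * (y * gen G a) = 0" using null_gen_sandwich[OF assms] by simp
qed

text \<open>Null generators come last, so for nonzero r the index \<open>dimn G\<close> is null. Its
  generator occurs twice in the square, which therefore vanishes.\<close>

lemma top_blade_square:
  obtains c where "blade G N * blade G N = scal G c 1" "rnum G \<noteq> 0 \<Longrightarrow> c = 0"
proof -
  have "blade G N * blade G N = 0" if r: "rnum G \<noteq> 0"
  proof -
    define a where "a = dimn G"
    have a: "a \<in> N" "\<not> a \<le> pnum G + qnum G" using r by (auto simp: a_def N_def dimn_def)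
    obtain k where k: "blade G (insert a (N - {a})) = scal G k (gen G a * blade G (N - {a}))"
      using blade_insert_ex[of "N - {a}" a] a by blast
    have "blade G N * blade G N
        = scal G (k * k) (gen G a * blade G (N - {a}) * gen G a * blade G (N - {a}))"
      using k a(1) by (simp add: insert_absorb scal_mult_left scal_mult_right mult.assoc)
    then show ?thesis using null_gen_sandwich[OF a] by simp
  qed
  moreover obtain c where "blade G N * blade G N = scal G c 1" using blade_square[of N] by blast
  ultimately show ?thesis using that[of c] that[of 0] by (cases "rnum G = 0") auto
qed

lemma jacobson_scal: "x \<in> jacobson_radical \<Longrightarrow> scal G c x \<in> jacobson_radical"
proof -
  assume "x \<in> jacobson_radical"
  then have "scal G c 1 * x \<in> jacobson_radical" using left_ideal_jacobson by (auto simp: left_ideal_def)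
  then show ?thesis by (simp add: scal_mult_left)
qed

lemma
  shows jacobson_zero: "(0::'a) \<in> jacobson_radical"
    and jacobson_add: "x \<in> jacobson_radical \<Longrightarrow> y \<in> jacobson_radical \<Longrightarrow> (x::'a) + y \<in> jacobson_radical"
    and jacobson_mult: "y \<in> jacobson_radical \<Longrightarrow> (x::'a) * y \<in> jacobson_radical"
  using left_ideal_jacobson by (auto simp: left_ideal_def)

lemma scalar_in_jacobson: "scal G c 1 \<in> jacobson_radical \<longleftrightarrow> c = 0"
proof
  assume "scal G c 1 \<in> jacobson_radical"
  then have "scal G (inverse c) (scal G c 1) \<in> jacobson_radical" by (rule jacobson_scal)
  then show "c = 0" using one_notin_jacobson by (auto simp: field_simps split: if_splits)
qed (simp add: jacobson_zero)

section \<open>The Grassmann subalgebra and its reduction modulo the radical\<close>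

lemma Lam_twist:
  assumes "x \<in> Lam G" "a \<in> N"
  shows "gen G a * x = hat G x * gen G a"
  using assms(1) unfolding Lam_def
proof (induction rule: generated_induct)
  case (mult x y)
  then show ?case by (metis hat_mult mult.assoc)
next
  case (gen x)
  then obtain b where b: "x = gen G b" "b \<in> N" "\<not> b \<le> pnum G + qnum G" by (auto simp: N_def)
  then show ?case
    using gen_anticommute[OF assms(2) b(2)] null_gen_square[OF b(2,3)]
    by (cases "a = b") (simp_all add: hat_gen)
qed (simp_all add: algebra_simps scal_mult_left scal_mult_right)

lemma Lam_even_subset_center: "Lam_even G \<subseteq> center"
  by (auto simp: Lam_even_def in_center_iff Lam_twist parity_0)

text \<open>The null generators vanish modulo the radical, so only a scalar survives.\<close>

lemma Lam_subset:
  assumes "x \<in> Lam G"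
  shows "\<exists>c. x - scal G c 1 \<in> jacobson_radical"
  using assms unfolding Lam_def
proof (induction rule: generated_induct)
  case one
  then show ?case by (auto simp: jacobson_zero intro: exI[of _ 1])
next
  case (scal c x)
  then obtain d where "scal G c (x - scal G d 1) \<in> jacobson_radical" using jacobson_scal by blast
  then show ?case by (auto simp: scale_right_diff_distrib intro: exI[of _ "c * d"])
next
  case (add x y)
  then obtain c d where "(x - scal G c 1) + (y - scal G d 1) \<in> jacobson_radical"
    using jacobson_add by blast
  then show ?case by (auto simp: algebra_simps intro: exI[of _ "c + d"])
next
  case (mult x y)
  then obtain c d where cd: "x - scal G c 1 \<in> jacobson_radical" "y - scal G d 1 \<in> jacobson_radical"
    by blast
  \<comment> \<open>The splitting keeps the radical elements on the right or multiplied by scalars,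
    so the left ideal property suffices.\<close>
  have "x * y - scal G (c * d) 1 = x * (y - scal G d 1) + scal G d (x - scal G c 1)"
    by (simp add: algebra_simps scal_mult_right scale_right_diff_distrib)
  also have "\<dots> \<in> jacobson_radical" using cd by (intro jacobson_add jacobson_mult jacobson_scal)
  finally show ?case by blast
next
  case (gen x)
  then obtain b where b: "x = gen G b" "b \<in> N" "\<not> b \<le> pnum G + qnum G" by (auto simp: N_def)
  then show ?case using null_gen_jacobson by (auto intro: exI[of _ 0])
qed

lemma in_grade_0_rad:
  "x \<in> grade G 0 + rad_even G \<longleftrightarrow>
    (\<exists>c y. x = scal G c 1 + y \<and> y \<in> jacobson_radical \<and> hat G y = y)"
  unfolding set_plus_def grade_0 rad_even_def by (simp add: Bex_def parity_0) blast

lemma in_grade_0n_rad: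
  "x \<in> grade_0n G + rad_even G \<longleftrightarrow>
    (\<exists>a b y. x = scal G a 1 + scal G b (blade G N) + y \<and> y \<in> jacobson_radical \<and> hat G y = y)"
  unfolding set_plus_def rad_even_def by (simp add: Bex_def parity_0 in_grade_0n) blast

lemma Lam_even_subset_rad: "Lam_even G \<subseteq> grade G 0 + rad_even G"
proof
  fix x assume x: "x \<in> Lam_even G"
  then obtain c where "x - scal G c 1 \<in> jacobson_radical" using Lam_subset by (auto simp: Lam_even_def)
  moreover have "hat G x = x" using x by (simp add: Lam_even_def parity_0)
  ultimately show "x \<in> grade G 0 + rad_even G"
    unfolding in_grade_0_rad by (intro exI[of _ c] exI[of _ "x - scal G c 1"]) simp
qed

text \<open>
  If two blades occur in a homogeneous element of the radical, the anticommutator with a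
  generator separating them kills one and keeps the other; so minimal support is a single blade,
  which is a unit when there are no null generators.
\<close>

lemma homogeneous_jacobson_zero:
  assumes r: "rnum G = 0" and "x \<in> jacobson_radical" "hat G x = x \<or> hat G x = - x"
  shows "x = 0"
  using assms(2,3)
proof (induction "card {A \<in> Pow N. cf A x \<noteq> 0}" arbitrary: x rule: less_induct)
  case less
  have nonnull: "a \<le> pnum G + qnum G" if "a \<in> N" for a using that r by (auto simp: N_def dimn_def)
  \<comment> \<open>A generator that is not null is a unit, so right multiplication by it preserves
    the radical.\<close>
  have jac_gen: "y * gen G a \<in> jacobson_radical" if y: "y \<in> jacobson_radical" and a: "a \<in> N" for y a
  proof -
    obtain c where c: "gen G a * gen G a = scal G c 1" "c \<noteq> 0"
      using gen_square[OF a] nonnull[OF a] by blast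
    show ?thesis
      using y c by (intro jacobson_mult_unit[where v = "scal G (inverse c) (gen G a)"])
        (simp_all add: scal_mult_left scal_mult_right)
  qed
  let ?supp = "\<lambda>x. {A \<in> Pow N. cf A x \<noteq> 0}"
  have same_parity: "even (card A) \<longleftrightarrow> even (card B)" if "A \<in> ?supp x" "B \<in> ?supp x" for A B
  proof -
    show ?thesis
      using less.prems(2) that cf_hat[of A x] cf_hat[of B x] eq_minus_iff[of "cf A x"] eq_minus_iff[of "cf B x"]
      by (cases "even (card A)"; cases "even (card B)") auto
  qed
  have unique: "A = B" if AB: "A \<in> ?supp x" "B \<in> ?supp x" for A B
  proof (rule ccontr)
    assume "A \<noteq> B"
    then obtain a where a: "a \<in> N" "(a \<in> A) \<noteq> (a \<in> B)" using AB by blast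
    define y where "y = gen G a * x + x * gen G a"
    have cfy: "\<exists>k. k \<noteq> 0 \<and> cf (toggle a C) y = (1 + (- 1) ^ card (C - {a})) * k * cf C x" if C: "C \<subseteq> N" for C
    proof -
      obtain k where "k \<noteq> 0" "cf (toggle a C) (gen G a * x) = k * cf C x"
        "cf (toggle a C) (x * gen G a) = (- 1) ^ card (C - {a}) * k * cf C x"
        using cf_gen_mult[OF C a(1) disjI2[OF nonnull[OF a(1)]]] by metis
      then show ?thesis by (intro exI[of _ k]) (simp add: y_def distrib_right)
    qed
    \<comment> \<open>The two sets have sizes of equal parity and exactly one contains a, so
      removing a makes the parities differ.\<close>
    have par: "even (card (A - {a})) \<noteq> even (card (B - {a}))"
    proof -
      have fin: "finite A" "finite B" using AB by (auto intro: finite_index)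
      have rem: "even (card (C - {a})) \<longleftrightarrow> (even (card C) \<longleftrightarrow> a \<notin> C)" if "finite C" for C
        using card.remove[OF that, of a] by (cases "a \<in> C") auto
      show ?thesis using rem[OF fin(1)] rem[OF fin(2)] a(2) same_parity[OF AB] by auto
    qed
    obtain K D where KD: "K \<in> ?supp x" "D \<in> ?supp x" "even (card (K - {a}))" "odd (card (D - {a}))"
    proof (cases "even (card (A - {a}))")
      case True
      then show ?thesis using par AB by (intro that[of A B]) auto
    next
      case False
      then show ?thesis using par AB by (intro that[of B A]) auto
    qed
    \<comment> \<open>The factor 1 + (-1)^m with m odd kills the coordinate of D, so the support of
      y is strictly smaller than that of x.\<close>
    have sub: "?supp y \<subseteq> toggle a ` (?supp x - {D})"
    proof
      fix C assume C: "C \<in> ?supp y"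
      then have tC: "toggle a C \<subseteq> N" using toggle_subset[OF a(1)] by simp
      obtain k where "cf C y = (1 + (- 1) ^ card (toggle a C - {a})) * k * cf (toggle a C) x"
        using cfy[OF tC] by auto
      then have "toggle a C \<in> ?supp x - {D}" using C KD(4) tC by auto
      then show "C \<in> toggle a ` (?supp x - {D})" by (intro image_eqI[of _ _ "toggle a C"]) simp_all
    qed
    have fin: "finite (?supp x)" by simp
    have "card (?supp y) \<le> card (toggle a ` (?supp x - {D}))"
      using sub fin by (intro card_mono) auto
    also have "\<dots> \<le> card (?supp x - {D})" using fin by (intro card_image_le) auto
    also have "\<dots> < card (?supp x)" using fin KD(2) by (intro card_Diff1_less)
    finally have smaller: "card (?supp y) < card (?supp x)" .
    have "y \<in> jacobson_radical"
      using less.prems(1) a(1) by (simp add: y_def jacobson_add jacobson_mult jac_gen)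
    moreover have "hat G y = y \<or> hat G y = - y"
      using less.prems(2) a(1) by (auto simp: y_def hat_gen)
    ultimately have "y = 0" by (rule less.hyps[OF smaller])
    \<comment> \<open>The coordinate coming from K is doubled up to a nonzero factor, contradicting
      y = 0.\<close>
    moreover obtain k where "k \<noteq> 0" "cf (toggle a K) y = (1 + (- 1) ^ card (K - {a})) * k * cf K x"
      using cfy KD(1) by blast
    ultimately show False using KD(1,3) two_neq_0 by simp
  qed
  show ?case
  proof (rule ccontr)
    assume "x \<noteq> 0"
    then obtain A where A: "A \<in> ?supp x" using cf_ext[of x 0] by auto
    define c where "c = cf A x"
    have c: "c \<noteq> 0" and A': "A \<subseteq> N" using A by (auto simp: c_def)
    have "x = scal G c (blade G A)"
    proof (rule cf_ext)
      fix B assume B: "B \<subseteq> N"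
      show "cf B x = cf B (scal G c (blade G A))"
      proof (cases "cf B x = 0")
        case True
        then show ?thesis using A' B by (auto simp: cf_blade c_def)
      next
        case False
        then have "A = B" using unique[OF A] B by simp
        then show ?thesis using B by (simp add: cf_blade c_def)
      qed
    qed
    then have "scal G (inverse c) x = blade G A" using c by simp
    then have "blade G A \<in> jacobson_radical" using jacobson_scal[OF less.prems(1)] by metis
    moreover have "finite A" using A' by (rule finite_index)
    \<comment> \<open>Multiplying by its own generators strips a blade down to 1, which is not in
      the radical.\<close>
    moreover have "blade G A \<notin> jacobson_radical" if "finite A" "A \<subseteq> N" for A
      using that
    proof (induction A rule: finite_induct)
      case (insert a A)
      then have a: "a \<in> N" "A \<subseteq> N" "a \<notin> A" by auto
      obtain k where k: "gen G a * blade G (insert a A) = scal G k (blade G (toggle a (insert a A)))" "k \<noteq> 0"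
        using gen_mult_blade[of "insert a A" a] nonnull a by blast
      moreover have "toggle a (insert a A) = A" using a(3) by (auto simp: toggle_def)
      ultimately have "scal G (inverse k) (gen G a * blade G (insert a A)) = blade G A" by simp
      then show ?case using insert.IH a(2) by (metis jacobson_mult jacobson_scal)
    qed (simp add: one_notin_jacobson)
    ultimately show False using A' by blast
  qed
qed

lemma rad_even_zero: "rnum G = 0 \<Longrightarrow> rad_even G = {0}"
  using homogeneous_jacobson_zero by (auto simp: rad_even_def parity_0 jacobson_zero)

section \<open>The center\<close>

lemma Lam_subalgebra: "subalgebra G (Lam G)"
  by (auto simp: Lam_def generated_subalgebra_def subalgebra_def subspace_def)

text \<open>All blades in the support are products of null generators, so the expansion stays in the
  Grassmann subalgebra; the even cardinalities make it fixed by \<open>hat G\<close>.\<close>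

lemma Lam_evenI:
  assumes supp: "\<And>A. A \<subseteq> N \<Longrightarrow> cf A w \<noteq> 0 \<Longrightarrow> even (card A) \<and> (\<forall>a\<in>A. \<not> a \<le> pnum G + qnum G)"
  shows "w \<in> Lam_even G"
proof -
  have Lam: "subspace (Lam G)" "1 \<in> Lam G" "\<And>x y. x \<in> Lam G \<Longrightarrow> y \<in> Lam G \<Longrightarrow> x * y \<in> Lam G"
    using Lam_subalgebra by (auto simp: subalgebra_def)
  have gens: "gen G a \<in> Lam G" if "a \<in> N" "\<not> a \<le> pnum G + qnum G" for a
    using that by (auto simp: Lam_def generated_subalgebra_def N_def)
  have prod: "prod_list (map (gen G) xs) \<in> Lam G" if "\<forall>a\<in>set xs. a \<in> N \<and> \<not> a \<le> pnum G + qnum G" for xs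
    using that by (induction xs) (auto simp: Lam gens)
  have blade: "blade G A \<in> Lam G" if "A \<subseteq> N" "\<forall>a\<in>A. \<not> a \<le> pnum G + qnum G" for A
    unfolding blade_def using that finite_index[OF that(1)] by (intro prod) auto
  have "(\<Sum>A\<in>Pow N. scal G (cf A w) (blade G A)) \<in> Lam G"
  proof (rule subspace_sum[OF Lam(1)])
    fix A assume "A \<in> Pow N"
    then show "scal G (cf A w) (blade G A) \<in> Lam G"
      using supp[of A] blade[of A] subspace_scale[OF Lam(1)] subspace_0[OF Lam(1)]
      by (cases "cf A w = 0") auto
  qed
  then have "w \<in> Lam G" using cf_expansion[of w] by simp
  moreover have "hat G w = w"
  proof (rule cf_ext)
    fix A assume "A \<subseteq> N"
    then show "cf A (hat G w) = cf A w" using supp[of A] by (cases "cf A w = 0") (auto simp: cf_hat)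
  qed
  ultimately show ?thesis by (simp add: Lam_even_def parity_0)
qed

text \<open>Comparing the coordinates of \<open>gen G a * z\<close> and \<open>z * gen G a\<close>
  at \<open>toggle a A\<close> forces \<open>card (A - {a})\<close> to be even whenever the product
  does not vanish. For even \<open>card A\<close> this excludes every nonnull a in A; for odd
  \<open>card A\<close> it forces every index into A.\<close>

lemma center_support:
  assumes z: "z \<in> center" and A: "A \<subseteq> N" and nz: "cf A z \<noteq> 0"
  shows "even (card A) \<and> (\<forall>a\<in>A. \<not> a \<le> pnum G + qnum G) \<or> odd (card A) \<and> A = N"
proof -
  have ev: "even (card (A - {a}))" if a: "a \<in> N" "a \<notin> A \<or> a \<le> pnum G + qnum G" for a
  proof (rule ccontr)
    assume odd: "odd (card (A - {a}))"
    obtain k where k: "k \<noteq> 0" "cf (toggle a A) (gen G a * z) = k * cf A z"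
      "cf (toggle a A) (z * gen G a) = (- 1) ^ card (A - {a}) * k * cf A z"
      using cf_gen_mult[OF A a] by metis
    have "gen G a * z = z * gen G a" using z by (simp add: center_def)
    then have "k * cf A z = - (k * cf A z)" using k(2,3) odd by simp
    then show False using k(1) nz by (simp add: eq_minus_iff)
  qed
  have fin: "finite A" using A by (rule finite_index)
  show ?thesis
  proof (cases "even (card A)")
    case True
    have "\<not> a \<le> pnum G + qnum G" if a: "a \<in> A" for a
    proof
      assume "a \<le> pnum G + qnum G"
      then have "even (card (A - {a}))" using ev A a by blast
      then show False using True card.remove[OF fin a] by simp
    qed
    then show ?thesis using True by blast
  next
    case False
    have "a \<in> A" if "a \<in> N" for a
      using ev[OF that] False by (cases "a \<in> A") auto
    then have "N \<subseteq> A" by blast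
    then show ?thesis using False A by auto
  qed
qed

lemma even_center: "z \<in> center \<Longrightarrow> hat G z = z \<Longrightarrow> z \<in> Lam_even G"
proof (rule Lam_evenI)
  fix A assume z: "z \<in> center" "hat G z = z" and A: "A \<subseteq> N" "cf A z \<noteq> 0"
  have "cf A z = (- 1) ^ card A * cf A z" using cf_hat[OF A(1), of z] z(2) by simp
  then have "even (card A)" using A(2) eq_minus_iff[of "cf A z"] by (cases "even (card A)") simp_all
  then show "even (card A) \<and> (\<forall>a\<in>A. \<not> a \<le> pnum G + qnum G)"
    using center_support[OF z(1) A] by auto
qed

lemma center_eq:
  "center = (if odd (dimn G) then Lam_even G + grade G (dimn G) else Lam_even G)"
proof (cases "odd (dimn G)")
  case True
  have "z \<in> Lam_even G + grade G (dimn G)" if z: "z \<in> center" for z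
  proof -
    \<comment> \<open>Removing the top coordinate leaves only even blades of null generators, by
      \<open>center_support\<close>.\<close>
    define w where "w = z - scal G (cf N z) (blade G N)"
    have "w \<in> Lam_even G"
    proof (rule Lam_evenI)
      fix A assume A: "A \<subseteq> N" "cf A w \<noteq> 0"
      then have "A \<noteq> N" "cf A z \<noteq> 0" by (auto simp: w_def cf_blade split: if_splits)
      then show "even (card A) \<and> (\<forall>a\<in>A. \<not> a \<le> pnum G + qnum G)"
        using center_support[OF z A(1)] by auto
    qed
    moreover have "z = w + scal G (cf N z) (blade G N)" by (simp add: w_def)
    ultimately show ?thesis unfolding grade_top by (auto simp: set_plus_def)
  qed
  moreover have "z \<in> center" if "z \<in> Lam_even G + grade G (dimn G)" for z
    using that Lam_even_subset_center top_blade_center[OF True]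
    by (auto simp: set_plus_def grade_top intro!: center_add center_scal)
  ultimately show ?thesis using True by auto
next
  case False
  have "z \<in> Lam_even G" if z: "z \<in> center" for z
  proof (rule Lam_evenI)
    fix A assume A: "A \<subseteq> N" "cf A z \<noteq> 0"
    then show "even (card A) \<and> (\<forall>a\<in>A. \<not> a \<le> pnum G + qnum G)"
      using center_support[OF z A] False by auto
  qed
  then show ?thesis using Lam_even_subset_center False by auto
qed

lemma ker_ad_check_eq: "ker_ad_check G = (Lam_even G)\<^sup>\<times>"
proof -
  have "(\<forall>U. hat G T * U * ring_inv T = U) \<longleftrightarrow> T \<in> Lam_even G" if T: "T \<in> UNIV\<^sup>\<times>" for T
  proof
    assume all: "\<forall>U. hat G T * U * ring_inv T = U"
    have *: "hat G T * U = U * T" for U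
    proof -
      have "hat G T * U = hat G T * U * ring_inv T * T" using ring_inv_left[OF T] by (simp add: mult.assoc)
      then show ?thesis using all by simp
    qed
    \<comment> \<open>Taking U = 1 shows that T is even, after which the twisted relation is
      ordinary centrality.\<close>
    from *[of 1] have even: "hat G T = T" by simp
    then have "T \<in> center" using * by (simp add: center_def)
    then show "T \<in> Lam_even G" using even by (rule even_center)
  next
    assume "T \<in> Lam_even G"
    then have hT: "hat G T = T" and comm: "T \<in> center"
      using Lam_even_subset_center by (auto simp: Lam_even_def parity_0)
    have "T * U * ring_inv T = U" for U
    proof -
      have "T * U = U * T" using comm unfolding center_def by blast
      then show ?thesis using ring_inv_right[OF T] by (simp add: mult.assoc)
    qed
    then show "\<forall>U. hat G T * U * ring_inv T = U" unfolding hT by blast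
  qed
  then show ?thesis unfolding ker_ad_check_def set_eq_iff invertibles_iff[of _ "Lam_even G"] by blast
qed

section \<open>The quotient of a unit by its grade involution\<close>

lemma square_one_modulo_jacobson:
  assumes y: "y \<in> jacobson_radical" and sq: "(scal G c 1 + y) * (scal G c 1 + y) = 1"
  shows "y = 0 \<and> (c = 1 \<or> c = - 1)"
proof -
  have expand: "scal G (c * c - 1) 1 + (scal G (2 * c) y + y * y) = 0"
  proof -
    have "(scal G c 1 + y) * (scal G c 1 + y) = scal G (c * c) 1 + (scal G c y + scal G c y) + y * y"
      by (simp add: algebra_simps scal_mult_left scal_mult_right)
    also have "scal G c y + scal G c y = scal G (2 * c) y" by (simp add: add_self)
    finally show ?thesis using sq by (simp add: scale_left_diff_distrib algebra_simps)
  qed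
  have in_jac: "scal G (2 * c) y + y * y \<in> jacobson_radical"
    using y by (intro jacobson_add jacobson_scal jacobson_mult)
  have "scal G (c * c - 1) 1 = - (scal G (2 * c) y + y * y)"
    using expand by (simp only: eq_neg_iff_add_eq_0)
  then have "scal G (c * c - 1) 1 \<in> jacobson_radical"
    using left_ideal_minus[OF left_ideal_jacobson in_jac] by simp
  then have "c * c = 1" by (simp add: scalar_in_jacobson)
  then have c: "c = 1 \<or> c = - 1" by (simp add: square_eq_1_iff)
  then have c2: "2 * c \<noteq> 0" using two_neq_0 by auto
  \<comment> \<open>Since c c = 1, the expansion says (2 c + y) y = 0. Dividing by 2 c turns the
    first factor into 1 plus a radical element, which has a left inverse.\<close>
  have "scal G (inverse (2 * c)) y \<in> jacobson_radical" using y by (rule jacobson_scal)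
  then obtain u where u: "u * (1 + scal G (inverse (2 * c)) y) = 1"
    using jacobson_left_inverse by blast
  have "scal G (2 * c) ((1 + scal G (inverse (2 * c)) y) * y) = scal G (2 * c) y + y * y"
    using c2 by (simp add: distrib_right scale_right_distrib scal_mult_left)
  also have "\<dots> = 0" using expand \<open>c * c = 1\<close> by simp
  finally have "(1 + scal G (inverse (2 * c)) y) * y = 0" using c2 by simp
  then have "y = 0" using u by (metis mult.assoc mult_1 mult_zero_right)
  with c show ?thesis by simp
qed

text \<open>Measures how far a unit T is from being homogeneous. It is meaningful only for units,
  since \<open>ring_inv\<close> is otherwise unspecified.\<close>

definition quot :: "'a \<Rightarrow> 'a" where
  "quot T = hat G (ring_inv T) * T"

lemma hat_inv:
  assumes "T \<in> UNIV\<^sup>\<times>"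
  shows "hat G T * hat G (ring_inv T) = 1" "hat G (ring_inv T) * hat G T = 1"
proof -
  have "hat G (T * ring_inv T) = hat G 1" "hat G (ring_inv T * T) = hat G 1"
    by (simp_all only: ring_inv_left[OF assms] ring_inv_right[OF assms])
  then show "hat G T * hat G (ring_inv T) = 1" "hat G (ring_inv T) * hat G T = 1" by simp_all
qed

lemma hat_unit: "x \<in> UNIV\<^sup>\<times> \<Longrightarrow> hat G x \<in> UNIV\<^sup>\<times>"
  using hat_inv unfolding mem_invertibles[of "hat G x"] by blast

lemma quot_unit: "T \<in> UNIV\<^sup>\<times> \<Longrightarrow> quot T \<in> UNIV\<^sup>\<times>"
  unfolding quot_def by (intro unit_mult hat_unit ring_inv_unit)

lemma hat_mult_quot: "T \<in> UNIV\<^sup>\<times> \<Longrightarrow> hat G T * quot T = T"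
  using hat_inv(1)[of T] by (simp add: quot_def flip: mult.assoc)

lemma hat_quot_mult_quot: "T \<in> UNIV\<^sup>\<times> \<Longrightarrow> hat G (quot T) * quot T = 1"
  using hat_mult_quot[of T] ring_inv_left[of T] by (simp add: quot_def mult.assoc)

lemma P_pm_iff: "T \<in> P_pm G \<longleftrightarrow> T \<in> UNIV\<^sup>\<times> \<and> (hat G T = T \<or> hat G T = - T)"
  unfolding P_pm_def Un_iff invertibles_iff[of T "parity_part G _"] parity_0 parity_1 by blast

lemma P_pm_iff_quot: "T \<in> UNIV\<^sup>\<times> \<Longrightarrow> T \<in> P_pm G \<longleftrightarrow> quot T = 1 \<or> quot T = - 1"
proof -
  assume T: "T \<in> UNIV\<^sup>\<times>"
  have "hat G T = T \<longleftrightarrow> quot T = 1"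
    using hat_mult_quot[OF T] hat_inv(2)[OF T] by (metis mult.right_neutral quot_def)
  moreover have "hat G T = - T \<longleftrightarrow> quot T = - 1"
    using hat_mult_quot[OF T] hat_inv(2)[OF T]
    by (metis minus_minus mult.right_neutral mult_minus_right quot_def)
  ultimately show ?thesis using T by (simp add: P_pm_iff)
qed

section \<open>The homogeneous units described by their quotients\<close>

lemma minus_one_scalar: "- 1 = scal G (- 1) 1"
  by simp

lemma zero_in_rad_even: "0 \<in> rad_even G"
  by (simp add: rad_even_def parity_0 jacobson_zero)

lemma subset_plus_rad_even: "X \<subseteq> X + rad_even G"
  using set_zero_plus2[OF zero_in_rad_even, of X] by (simp only: add.commute)

text \<open>The set X is left free between two bounds so that several descriptions follow at once. A
  quotient in the larger bound is even, so its square is 1, which leaves only 1 and -1.\<close>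

lemma P_pm_eq_quot:
  assumes "grade G 0 \<subseteq> X" "X \<subseteq> grade G 0 + rad_even G"
  shows "P_pm G = {T \<in> UNIV\<^sup>\<times>. quot T \<in> X\<^sup>\<times>}"
proof -
  have "T \<in> P_pm G \<longleftrightarrow> quot T \<in> X" if T: "T \<in> UNIV\<^sup>\<times>" for T
  proof
    assume "T \<in> P_pm G"
    then have "quot T \<in> grade G 0"
      using P_pm_iff_quot[OF T] scale_one[of 1] minus_one_scalar unfolding grade_0 by (metis rangeI)
    then show "quot T \<in> X" using assms(1) by blast
  next
    assume "quot T \<in> X"
    then obtain c y where cy: "quot T = scal G c 1 + y" "y \<in> jacobson_radical" "hat G y = y"
      using assms(2) in_grade_0_rad by blast
    have "hat G (quot T) = quot T" using cy by simp
    then have "(scal G c 1 + y) * (scal G c 1 + y) = 1"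
      using hat_quot_mult_quot[OF T] cy(1) by simp
    then have "y = 0 \<and> (c = 1 \<or> c = - 1)" by (rule square_one_modulo_jacobson[OF cy(2)])
    then show "T \<in> P_pm G" using cy(1) P_pm_iff_quot[OF T] by auto
  qed
  moreover have "P_pm G \<subseteq> UNIV\<^sup>\<times>" using P_pm_iff by blast
  ultimately show ?thesis using quot_unit by (auto simp: invertibles_iff[of _ X])
qed

lemma grade_0n_mult:
  assumes "blade G N * blade G N = scal G k 1"
  shows "(scal G a 1 + scal G b (blade G N)) * (scal G c 1 + scal G d (blade G N)) =
    scal G (a * c + b * d * k) 1 + scal G (a * d + b * c) (blade G N)"
  by (simp add: algebra_simps scal_mult_left scal_mult_right assms scale_left_distrib)

lemma scalar_eq_iff: "scal G c 1 = scal G d 1 \<longleftrightarrow> c = d"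
proof
  assume "scal G c 1 = scal G d 1"
  then have "cf {} (scal G c 1) = cf {} (scal G d 1)" by simp
  then show "c = d" by (simp add: cf_one)
qed simp

text \<open>
  If the quotient were a multiple \<open>S\<close> of the top blade, then \<open>T = hat T * S = S * T\<close>, so \<open>S = 1\<close>.
\<close>

lemma P_pm_eq_quot_nondegenerate:
  assumes n: "even (dimn G)" "dimn G \<noteq> 0"
  shows "P_pm G = {T \<in> UNIV\<^sup>\<times>. quot T \<in> (grade_0n G)\<^sup>\<times>}"
proof -
  have N: "N \<noteq> {}" using n(2) by (auto simp: N_def)
  have "quot T \<in> grade G 0" if T: "T \<in> UNIV\<^sup>\<times>" and q: "quot T \<in> grade_0n G" for T
  proof -
    obtain a b where ab: "quot T = scal G a 1 + scal G b (blade G N)" using q in_grade_0n by blast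
    obtain k where k: "blade G N * blade G N = scal G k 1" using top_blade_square by blast
    have "hat G (quot T) = quot T" using n(1) by (simp add: ab hat_top_blade)
    then have "quot T * quot T = 1" using hat_quot_mult_quot[OF T] by simp
    then have "scal G (a * a + b * b * k) 1 + scal G (a * b + b * a) (blade G N) = 1"
      unfolding ab grade_0n_mult[OF k] .
    \<comment> \<open>The coordinate at N is 2 a b on the left and 0 on the right, because N is
      nonempty.\<close>
    from arg_cong[OF this, of "cf N"] have "2 * (a * b) = 0"
      using N by (simp add: cf_one cf_blade mult.commute)
    then consider "b = 0" | "a = 0" using two_neq_0 by auto
    then show ?thesis
    proof cases
      case 1
      then show ?thesis by (simp add: ab grade_0)
    next
      case 2
      have "quot T * T = hat G T * quot T"
        using 2 top_blade_twist[OF n(1), of T] by (simp add: ab scal_mult_left scal_mult_right)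
      also have "\<dots> = T" by (rule hat_mult_quot[OF T])
      finally have "quot T * T * ring_inv T = T * ring_inv T" by simp
      then have "quot T = 1" using ring_inv_right[OF T] by (simp add: mult.assoc)
      then show ?thesis unfolding grade_0 by (metis rangeI scale_one)
    qed
  qed
  moreover have "P_pm G = {T \<in> UNIV\<^sup>\<times>. quot T \<in> (grade G 0)\<^sup>\<times>}"
    by (intro P_pm_eq_quot order_refl subset_plus_rad_even)
  ultimately show ?thesis
    using grade_0_subset_0n
    by (auto simp: invertibles_iff[of _ "grade G 0"] invertibles_iff[of _ "grade_0n G"])
qed

text \<open>For r = 0 the even part of the radical is trivial. Otherwise the central top blade
  squares to zero, so its term drops out of \<open>hat G S * S = 1\<close> and a scalar plus a
  radical element with square 1 remains.\<close>

lemma odd_quot_in_grade_0n: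
  assumes n: "odd (dimn G)" and S: "S \<in> grade_0n G + rad_even G" "hat G S * S = 1"
  shows "S \<in> grade_0n G"
proof -
  obtain a b y where y: "S = scal G a 1 + scal G b (blade G N) + y" "y \<in> jacobson_radical" "hat G y = y"
    using S(1) in_grade_0n_rad by blast
  have "y = 0"
  proof (cases "rnum G = 0")
    case True
    then show ?thesis using y by (intro homogeneous_jacobson_zero) auto
  next
    case False
    then have sq: "blade G N * blade G N = 0" using top_blade_square by (metis scale_zero_left)
    define u where "u = scal G a 1 + y"
    define v where "v = scal G b (blade G N)"
    have Suv: "S = u + v" by (simp add: u_def v_def y(1))
    have hS: "hat G S = u - v" using n by (simp add: u_def v_def y(1,3) hat_top_blade)
    have "(u - v) * (u + v) = 1" using S(2) unfolding hS unfolding Suv .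
    moreover have "v * v = 0" by (simp add: v_def scal_mult_left scal_mult_right sq)
    moreover have "v \<in> center" using top_blade_center[OF n] by (simp add: v_def center_scal)
    then have "v * u = u * v" by (simp add: center_def)
    ultimately have "u * u = 1" by (simp add: algebra_simps)
    then show ?thesis using square_one_modulo_jacobson[OF y(2)] by (simp add: u_def)
  qed
  then show ?thesis using y(1) by (auto simp: in_grade_0n)
qed

text \<open>
  \<open>T \<plusminus> hat T\<close> is homogeneous and equals \<open>T * z\<close> with \<open>z\<close> in the center; for one of the two signs
  \<open>z\<close> is invertible.
\<close>

lemma odd_factorization:
  assumes n: "odd (dimn G)" and T: "T \<in> UNIV\<^sup>\<times>" and q: "quot T \<in> grade_0n G"
  shows "T \<in> P_pm G * (grade_0n G)\<^sup>\<times>"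
proof -
  let ?E = "blade G N"
  obtain a b where ab: "quot T = scal G a 1 + scal G b ?E" using q in_grade_0n by blast
  obtain k where k: "?E * ?E = scal G k 1" using top_blade_square by blast
  have hq: "hat G (quot T) = scal G a 1 + scal G (- b) ?E" using n by (simp add: ab hat_top_blade)
  have "(scal G a 1 + scal G (- b) ?E) * (scal G a 1 + scal G b ?E) = 1"
    using hat_quot_mult_quot[OF T] hq ab by simp
  moreover have "a * a + - b * b * k = a * a - b * b * k" "a * b + - b * a = 0" by simp_all
  ultimately have "scal G (a * a - b * b * k) 1 = scal G 1 1"
    unfolding grade_0n_mult[OF k] by (simp only: scale_zero_left add_0_right scale_one)
  then have norm: "a * a - b * b * k = 1" unfolding scalar_eq_iff .
  have "hat G (hat G T * quot T) = hat G T" using hat_mult_quot[OF T] by simp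
  then have hT: "hat G T = T * hat G (quot T)" by simp
  \<comment> \<open>The elements 1 + a and 1 - a cannot both vanish, as their sum is 2.\<close>
  obtain s where s: "s = 1 \<or> s = - 1" "1 + s * a \<noteq> (0::'f)"
  proof (cases "1 + a = 0")
    case True
    then have "1 + (- 1) * a = 2" by (simp add: eq_neg_iff_add_eq_0[symmetric] add.commute)
    then show ?thesis using two_neq_0 that[of "- 1"] by simp
  qed (use that[of 1] in simp)
  have ss: "s * s = 1" using s(1) by auto
  define U where "U = T + scal G s (hat G T)"
  \<comment> \<open>This is 1 + s \<open>hat G (quot T)\<close>, the factor in
    \<open>U = T * z\<close> that comes from \<open>hat G T = T * hat G (quot T)\<close>.\<close>
  define z where "z = scal G (1 + s * a) 1 + scal G (- (s * b)) ?E"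
  define d where "d = 2 * (1 + s * a)"
  \<comment> \<open>The inverse of z: its conjugate divided by its norm, which equals d because a a
    - b b k = 1 and s s = 1.\<close>
  define w where "w = scal G ((1 + s * a) / d) 1 + scal G (s * b / d) ?E"
  have d: "d \<noteq> 0" unfolding d_def using s(2) two_neq_0 by (intro no_zero_divisors)
  have "(1 + s * a) * (1 + s * a) - s * b * (s * b) * k = 1 + 2 * s * a + s * s * (a * a - b * b * k)"
    by (simp add: algebra_simps)
  also have "\<dots> = d" unfolding norm ss d_def by (simp add: algebra_simps)
  finally have det: "((1 + s * a) * (1 + s * a) - s * b * (s * b) * k) / d = 1" using d by simp
  have zw: "z * w = 1"
    unfolding z_def w_def grade_0n_mult[OF k] using det by (simp add: diff_divide_distrib)
  have wz: "w * z = 1"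
    unfolding z_def w_def grade_0n_mult[OF k] using det by (simp add: diff_divide_distrib mult.commute)
  have U: "U = T * z"
    unfolding U_def hT hq z_def
    by (simp add: algebra_simps scal_mult_right scale_left_distrib scale_right_diff_distrib)
  have "z \<in> UNIV\<^sup>\<times>" using zw wz by (auto simp: mem_invertibles)
  then have "U \<in> UNIV\<^sup>\<times>" unfolding U using T by (intro unit_mult)
  moreover have "hat G U = scal G s U"
    by (simp add: U_def scale_right_distrib ss add.commute)
  ultimately have "U \<in> P_pm G" using s(1) by (auto simp: P_pm_iff)
  moreover have "w \<in> (grade_0n G)\<^sup>\<times>"
    using zw wz by (auto simp: mem_invertibles w_def[symmetric] in_grade_0n) (metis w_def)
  moreover have "T = U * w" by (simp add: U mult.assoc zw)
  ultimately show ?thesis unfolding set_times_def by blast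
qed

section \<open>Central factors and the group \<open>P_group\<close>\<close>

lemma center_subset_odd: "odd (dimn G) \<Longrightarrow> (center :: 'a set) \<subseteq> grade_0n G + rad_even G"
proof
  fix z :: 'a assume n: "odd (dimn G)" and "z \<in> center"
  then obtain l b where l: "l \<in> Lam_even G" "z = l + scal G b (blade G N)"
    by (auto simp: center_eq set_plus_def grade_top)
  then obtain c y where "l = scal G c 1 + y" "y \<in> jacobson_radical" "hat G y = y"
    using Lam_even_subset_rad in_grade_0_rad by blast
  then show "z \<in> grade_0n G + rad_even G"
    unfolding in_grade_0n_rad using l(2)
    by (intro exI[of _ c] exI[of _ b] exI[of _ y]) (simp add: algebra_simps)
qed

lemma grade_0n_subset_center: "odd (dimn G) \<Longrightarrow> grade_0n G \<subseteq> center"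
  using top_blade_center by (auto simp: in_grade_0n intro!: center_add center_scal scalar_center)

lemma center_mult: "x \<in> center \<Longrightarrow> y \<in> center \<Longrightarrow> (x::'a) * y \<in> center"
  unfolding center_def mem_Collect_eq by (metis mult.assoc)

lemma ring_inv_center:
  assumes "z \<in> center\<^sup>\<times>"
  shows "ring_inv z \<in> center"
  unfolding center_def
proof (intro CollectI allI)
  fix x
  have "z * x = x * z" using assms by (simp add: mem_invertibles center_def)
  then have "ring_inv z * (z * x) * ring_inv z = ring_inv z * (x * z) * ring_inv z" by simp
  then show "ring_inv z * x = x * ring_inv z"
    using ring_inv_left[OF assms] ring_inv_right[OF assms]
    by (metis mult.assoc mult.right_neutral mult_1)
qed

text \<open>For T = U z with U homogeneous and z central, the quotient of U is 1 or -1. The quotient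
  of T is then, up to sign, \<open>hat G (ring_inv z) * z\<close>, a product of central
  elements.\<close>

lemma P_group_quot_center:
  assumes "T \<in> P_group G"
  shows "T \<in> UNIV\<^sup>\<times> \<and> quot T \<in> center"
proof -
  obtain U z where Uz: "T = U * z" "U \<in> P_pm G" "z \<in> center\<^sup>\<times>"
    using assms by (auto simp: P_group_def set_times_def)
  have U: "U \<in> UNIV\<^sup>\<times>" using Uz(2) P_pm_iff by blast
  have z: "z \<in> UNIV\<^sup>\<times>" "z \<in> center" using Uz(3) by (auto simp: mem_invertibles)
  have inv: "ring_inv T = ring_inv z * ring_inv U"
  proof (rule ring_inv_eqI)
    have "T * (ring_inv z * ring_inv U) = U * (z * ring_inv z) * ring_inv U"
      by (simp add: Uz(1) mult.assoc)
    then show "T * (ring_inv z * ring_inv U) = 1"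
      by (simp add: ring_inv_right[OF z(1)] ring_inv_right[OF U])
    have "ring_inv z * ring_inv U * T = ring_inv z * (ring_inv U * U) * z"
      by (simp add: Uz(1) mult.assoc)
    then show "ring_inv z * ring_inv U * T = 1"
      by (simp add: ring_inv_left[OF z(1)] ring_inv_left[OF U])
  qed
  have "quot T = hat G (ring_inv z) * quot U * z"
    unfolding quot_def inv by (simp add: Uz(1) mult.assoc)
  then have "quot T = hat G (ring_inv z) * z \<or> quot T = - (hat G (ring_inv z) * z)"
    using P_pm_iff_quot[OF U] Uz(2) by auto
  moreover have "hat G (ring_inv z) * z \<in> center"
    using hat_center[OF ring_inv_center[OF Uz(3)]] z(2) by (rule center_mult)
  ultimately have "quot T \<in> center" by (auto simp: center_def)
  then show ?thesis using unit_mult[OF U z(1)] Uz(1) by simp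
qed

text \<open>For even n all central elements are even, so a central unit factor does not change
  parity.\<close>

lemma P_group_even: "even (dimn G) \<Longrightarrow> P_group G = P_pm G"
proof (intro subset_antisym subsetI)
  fix T assume "even (dimn G)" "T \<in> P_group G"
  then obtain U z where Uz: "T = U * z" "U \<in> P_pm G" "z \<in> (Lam_even G)\<^sup>\<times>"
    by (auto simp: P_group_def set_times_def center_eq)
  have "hat G z = z" using Uz(3) by (simp add: mem_invertibles Lam_even_def parity_0)
  moreover have "z \<in> UNIV\<^sup>\<times>" using Uz(3) by (auto simp: mem_invertibles)
  ultimately show "T \<in> P_pm G" using Uz(1,2) unit_mult by (auto simp: P_pm_iff)
next
  fix T assume "T \<in> P_pm G"
  moreover have "1 \<in> center\<^sup>\<times>" by (auto simp: mem_invertibles center_def)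
  moreover have "T = T * 1" by simp
  ultimately show "T \<in> P_group G" unfolding P_group_def set_times_def by blast
qed

text \<open>A cycle of inclusions: a member of the group has a central quotient, which then lies in
  \<open>grade_0n G\<close>; such a T factors as a homogeneous unit times a unit of
  \<open>grade_0n G\<close>, and the latter is central. Hence every X between the two bounds imposes
  the same condition.\<close>

lemma P_group_odd:
  assumes n: "odd (dimn G)"
  shows "P_group G = P_pm G * (grade_0n G)\<^sup>\<times>"
    and "grade_0n G \<subseteq> X \<Longrightarrow> X \<subseteq> grade_0n G + rad_even G \<Longrightarrow>
      P_group G = {T \<in> UNIV\<^sup>\<times>. quot T \<in> X\<^sup>\<times>}"
proof -
  have prod: "P_pm G * (grade_0n G)\<^sup>\<times> \<subseteq> P_group G"
    unfolding P_group_def using invertibles_mono[OF grade_0n_subset_center[OF n]]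
    by (intro set_times_mono2) auto
  have group: "T \<in> UNIV\<^sup>\<times> \<and> quot T \<in> grade_0n G" if "T \<in> P_group G" for T
    using P_group_quot_center[OF that] center_subset_odd[OF n]
      odd_quot_in_grade_0n[OF n _ hat_quot_mult_quot] by blast
  show eq: "P_group G = P_pm G * (grade_0n G)\<^sup>\<times>"
    using prod group odd_factorization[OF n] by (intro subset_antisym subsetI) blast+
  show "P_group G = {T \<in> UNIV\<^sup>\<times>. quot T \<in> X\<^sup>\<times>}"
    if X: "grade_0n G \<subseteq> X" "X \<subseteq> grade_0n G + rad_even G"
  proof -
    have "T \<in> P_group G" if "T \<in> UNIV\<^sup>\<times>" "quot T \<in> X" for T
    proof -
      have "quot T \<in> grade_0n G + rad_even G" using that(2) X(2) by blast
      then have "quot T \<in> grade_0n G"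
        using hat_quot_mult_quot[OF that(1)] by (rule odd_quot_in_grade_0n[OF n])
      then show ?thesis unfolding eq by (rule odd_factorization[OF n that(1)])
    qed
    then have "T \<in> P_group G \<longleftrightarrow> T \<in> UNIV\<^sup>\<times> \<and> quot T \<in> X\<^sup>\<times>" for T
      unfolding invertibles_iff[of "quot T" X] using group[of T] X(1) quot_unit[of T] by blast
    then show ?thesis by blast
  qed
qed

end

theorem theorem4p8:
  fixes G :: "('f::field, 'a::ring_1) geom_alg" and p q r n :: nat
  assumes "geometric_algebra G"
    and "pnum G = p" and "qnum G = q" and "rnum G = r"
    and "n = p + q + r" and "n \<ge> 1"
  shows
    "P_group G =
       (if odd n then ((parity_part G 0)\<^sup>\<times> \<union> (parity_part G 1)\<^sup>\<times>) * (grade_0n G)\<^sup>\<times>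
        else (parity_part G 0)\<^sup>\<times> \<union> (parity_part G 1)\<^sup>\<times>)
     \<and> P_group G = {T \<in> UNIV\<^sup>\<times>. hat G (ring_inv T) * T \<in> (S_space G)\<^sup>\<times>}
     \<and> P_group G = {T \<in> UNIV\<^sup>\<times>. hat G (ring_inv T) * T \<in> ker_ad}
     \<and> P_group G =
       (if odd n then {T \<in> UNIV\<^sup>\<times>. hat G (ring_inv T) * T \<in> (grade_0n G + rad_even G)\<^sup>\<times>}
        else {T \<in> UNIV\<^sup>\<times>. hat G (ring_inv T) * T \<in> (grade G 0 + rad_even G)\<^sup>\<times>})
     \<and> P_group G =
       (if even n \<and> r \<noteq> 0
        then {T \<in> UNIV\<^sup>\<times>. hat G (ring_inv T) * T \<in> (grade G 0 + rad_even G)\<^sup>\<times>}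
        else {T \<in> UNIV\<^sup>\<times>. hat G (ring_inv T) * T \<in> (grade_0n G + rad_even G)\<^sup>\<times>})
     \<and> (S_space G)\<^sup>\<times> = (if odd n then (grade G 0 + grade G n)\<^sup>\<times> else (grade G 0)\<^sup>\<times>)
     \<and> (ker_ad :: 'a set) = (if odd n then (Lam_even G + grade G n)\<^sup>\<times> else (Lam_even G)\<^sup>\<times>)
     \<and> P_pm G = (parity_part G 0)\<^sup>\<times> \<union> (parity_part G 1)\<^sup>\<times>
     \<and> P_pm G = {T \<in> UNIV\<^sup>\<times>. hat G (ring_inv T) * T \<in> (grade G 0)\<^sup>\<times>}
     \<and> P_pm G = {T \<in> UNIV\<^sup>\<times>. hat G (ring_inv T) * T \<in> (Lam_even G)\<^sup>\<times>}
     \<and> (Lam_even G)\<^sup>\<times> = ker_ad_check G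
     \<and> P_pm G = {T \<in> UNIV\<^sup>\<times>. hat G (ring_inv T) * T \<in> (grade G 0 + rad_even G)\<^sup>\<times>}
     \<and> P_pm G =
       (if even n \<and> r = 0
        then {T \<in> UNIV\<^sup>\<times>. hat G (ring_inv T) * T \<in> (grade_0n G + rad_even G)\<^sup>\<times>}
        else {T \<in> UNIV\<^sup>\<times>. hat G (ring_inv T) * T \<in> (grade G 0 + rad_even G)\<^sup>\<times>})"
proof -
  interpret geometric_algebra G by fact
  have n: "n = dimn G" using assms by (simp add: dimn_def)
  have n0: "dimn G \<noteq> 0" using assms(6) n by linarith
  have g0: "grade G 0 \<subseteq> grade G 0 + rad_even G"
    and g0n: "grade_0n G \<subseteq> grade_0n G + rad_even G"
    by (rule subset_plus_rad_even)+
  have Lam: "grade G 0 \<subseteq> Lam_even G"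
    using scalar_center by (auto simp: grade_0 intro: even_center)
  note pm = P_pm_eq_quot[unfolded quot_def]
  have S: "S_space G = (if odd n then grade_0n G else grade G 0)"
    by (simp add: S_space_def grade_0n_def n)
  have odd: "P_group G = P_pm G * (grade_0n G)\<^sup>\<times>"
    "P_group G = {T \<in> UNIV\<^sup>\<times>. hat G (ring_inv T) * T \<in> (grade_0n G)\<^sup>\<times>}"
    "P_group G = {T \<in> UNIV\<^sup>\<times>. hat G (ring_inv T) * T \<in> center\<^sup>\<times>}"
    "P_group G = {T \<in> UNIV\<^sup>\<times>. hat G (ring_inv T) * T \<in> (grade_0n G + rad_even G)\<^sup>\<times>}"
    if "odd n"
  proof -
    have odd_dim: "odd (dimn G)" using that n by simp
    note group = P_group_odd(2)[OF odd_dim, unfolded quot_def]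
    show "P_group G = P_pm G * (grade_0n G)\<^sup>\<times>" by (rule P_group_odd(1)[OF odd_dim])
    show "P_group G = {T \<in> UNIV\<^sup>\<times>. hat G (ring_inv T) * T \<in> (grade_0n G)\<^sup>\<times>}"
      by (rule group[OF order_refl g0n])
    show "P_group G = {T \<in> UNIV\<^sup>\<times>. hat G (ring_inv T) * T \<in> center\<^sup>\<times>}"
      by (rule group[OF grade_0n_subset_center[OF odd_dim] center_subset_odd[OF odd_dim]])
    show "P_group G = {T \<in> UNIV\<^sup>\<times>. hat G (ring_inv T) * T \<in> (grade_0n G + rad_even G)\<^sup>\<times>}"
      by (rule group[OF g0n order_refl])
  qed
  have even: "P_group G = P_pm G" if "even n"
    using P_group_even that n by simp
  have nondegenerate:
    "P_pm G = {T \<in> UNIV\<^sup>\<times>. hat G (ring_inv T) * T \<in> (grade_0n G + rad_even G)\<^sup>\<times>}"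
    if "even n" "r = 0"
  proof -
    \<comment> \<open>Without null generators the even radical vanishes, so adding it to
      \<open>grade_0n G\<close> changes nothing.\<close>
    have "rad_even G = 0" using rad_even_zero that assms by simp
    then show ?thesis using P_pm_eq_quot_nondegenerate[unfolded quot_def] that n n0 by simp
  qed
  note pms = pm[OF order_refl g0] pm[OF Lam Lam_even_subset_rad] pm[OF g0 order_refl]
  have center: "(center :: 'a set) = (if odd n then Lam_even G + grade G n else Lam_even G)"
    unfolding n by (rule center_eq)
  have top: "grade_0n G = grade G 0 + grade G n" by (simp add: grade_0n_def n)
  show ?thesis
  proof (cases "odd n")
    case True
    show ?thesis
      unfolding S P_pm_def[symmetric] ker_ad_eq_center ker_ad_check_eq top[symmetric]
      using odd[OF True] pms True center by auto
  next
    case False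
    then show ?thesis
      unfolding S P_pm_def[symmetric] ker_ad_eq_center ker_ad_check_eq top[symmetric]
      using even pms nondegenerate center by auto
  qed
qed

end
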